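(* Let $G$ be a $\delta$-negatively curved group (with respect to a fixed finite generating set) and let $\mu \ge 0$. There exists a constant $C_0$, depending only on $G$, $\delta$ and $\mu$, with the following property. Let $H$ and $K$ be any $\mu$-quasiconvex subgroups of $G$ and put $G_0 = H \cap K$. Let $H_1 \le H$ and $K_1 \le K$ be any subgroups with $H_1 \cap K_1 = H \cap K = G_0$. If all the elements of $H_1$ and all the elements of $K_1$ which are shorter than $C_0$ belong to $G_0$, then $\langle H_1, K_1\rangle = H_1 *_{G_0} K_1$. If, in addition, $H_1$ and $K_1$ are quasiconvex in $G$, then the subgroup $\langle H_1, K_1\rangle$ is quasiconvex in $G$.
   Context: $G$ is a group with a fixed finite generating set $X$, and $X^* = \{x, x^{-1} : x \in X\}$. $\mathrm{Cayley}(G)$ is the Cayley graph of $G$ with respect to $X^*$: its vertex set is $G$, its edge set is $G \times X^*$, and the edge $(g,x)$ joins $g$ to $gx$. The length of an element of $G$ is its word length with respect to $X^*$, and "shorter than $C_0$" means having length strictly less than $C_0$. A geodesic is a shortest path joining two vertices of $\mathrm{Cayley}(G)$. The group $G$ is $\delta$-negatively curved ($\delta \ge 0$) if any side of any geodesic triangle in $\mathrm{Cayley}(G)$ belongs to the $\delta$-neighborhood of the union of the two other sides. A subgroup $H$ of $G$ is $\mu$-quasiconvex in $G$ if any geodesic in $\mathrm{Cayley}(G)$ with both endpoints in $H$ belongs to the $\mu$-neighborhood of $H$; it is quasiconvex in $G$ if it is $\mu'$-quasiconvex for some $\mu' \ge 0$. $\langle H_1, K_1\rangle$ denotes the smallest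 subgroup of $G$ containing $H_1$ and $K_1$. The equality $\langle H_1, K_1\rangle = H_1 *_{G_0} K_1$ means that the natural homomorphism from the free product of $H_1$ and $K_1$ amalgamated along $G_0$ to $\langle H_1, K_1\rangle$, induced by the inclusions of $H_1$ and $K_1$ in $G$, is an isomorphism. *)

theory Defs
  imports "HOL-Algebra.Generated_Groups" "Graph_Theory.Graph_Theory"
begin

section \<open>Cayley graphs\<close>

definition sym_gens :: "('a, 'm) monoid_scheme \<Rightarrow> 'a set \<Rightarrow> 'a set" where
  "sym_gens G S = S \<union> (\<lambda>x. inv\<^bsub>G\<^esub> x) ` S"

definition cayley :: "('a, 'm) monoid_scheme \<Rightarrow> 'a set \<Rightarrow> ('a, 'a \<times> 'a) pre_digraph" where
  "cayley G S = \<lparr>verts = carrier G, arcs = carrier G \<times> sym_gens G S,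
     tail = fst, head = (\<lambda>(g, x). g \<otimes>\<^bsub>G\<^esub> x)\<rparr>"

text \<open>The edge \<open>(g, x)\<close> traversed backwards has the same effect as the edge
  \<open>(g x, x\<inverse>)\<close>, so the directed walks below realise all paths of the Cayley graph.\<close>

definition cayley_dist :: "('a, 'm) monoid_scheme \<Rightarrow> 'a set \<Rightarrow> 'a \<Rightarrow> 'a \<Rightarrow> ereal" where
  "cayley_dist G S u v = wf_digraph.\<mu> (cayley G S) (\<lambda>_. 1) u v"

definition word_length :: "('a, 'm) monoid_scheme \<Rightarrow> 'a set \<Rightarrow> 'a \<Rightarrow> nat" where
  "word_length G S g =
     (LEAST n. \<exists>w. set w \<subseteq> sym_gens G S \<and> length w = n \<and> foldr (\<otimes>\<^bsub>G\<^esub>) w \<one>\<^bsub>G\<^esub> = g)"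

definition geodesic ::
  "('a, 'm) monoid_scheme \<Rightarrow> 'a set \<Rightarrow> 'a \<Rightarrow> ('a \<times> 'a) awalk \<Rightarrow> 'a \<Rightarrow> bool" where
  "geodesic G S u p v \<longleftrightarrow> pre_digraph.awalk (cayley G S) u p v \<and>
     (\<forall>q. pre_digraph.awalk (cayley G S) u q v \<longrightarrow> length p \<le> length q)"

definition path_verts ::
  "('a, 'm) monoid_scheme \<Rightarrow> 'a set \<Rightarrow> 'a \<Rightarrow> ('a \<times> 'a) awalk \<Rightarrow> 'a set" where
  "path_verts G S u p = set (pre_digraph.awalk_verts (cayley G S) u p)"

text \<open>Neighborhoods are closed, and they consist of vertices. If a point inside an edge is
  within distance \<open>r\<close> of a vertex, then so is an end of that edge; hence a triangle that is
  thin (a subset that is quasiconvex) in the geometric realisation of the graph is so, with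
  the same constant, in the sense below. Conversely, the vertex versions imply the versions
  for all points of the edges with the constant increased by 1.\<close>

definition nbhd :: "('a, 'm) monoid_scheme \<Rightarrow> 'a set \<Rightarrow> real \<Rightarrow> 'a set \<Rightarrow> 'a set" where
  "nbhd G S r T = {v \<in> carrier G. \<exists>t\<in>T. cayley_dist G S t v \<le> ereal r}"

definition negatively_curved :: "('a, 'm) monoid_scheme \<Rightarrow> 'a set \<Rightarrow> real \<Rightarrow> bool" where
  "negatively_curved G S \<delta> \<longleftrightarrow>
     (\<forall>a b c p q r. geodesic G S a p b \<and> geodesic G S b q c \<and> geodesic G S c r a \<longrightarrow>
        path_verts G S a p \<subseteq> nbhd G S \<delta> (path_verts G S b q \<union> path_verts G S c r) \<and>
        path_verts G S b q \<subseteq> nbhd G S \<delta> (path_verts G S c r \<union> path_verts G S a p) \<and>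
        path_verts G S c r \<subseteq> nbhd G S \<delta> (path_verts G S a p \<union> path_verts G S b q))"

definition quasiconvex_with ::
  "('a, 'm) monoid_scheme \<Rightarrow> 'a set \<Rightarrow> real \<Rightarrow> 'a set \<Rightarrow> bool" where
  "quasiconvex_with G S \<mu> H \<longleftrightarrow>
     (\<forall>u\<in>H. \<forall>v\<in>H. \<forall>p. geodesic G S u p v \<longrightarrow> path_verts G S u p \<subseteq> nbhd G S \<mu> H)"

definition quasiconvex :: "('a, 'm) monoid_scheme \<Rightarrow> 'a set \<Rightarrow> 'a set \<Rightarrow> bool" where
  "quasiconvex G S H \<longleftrightarrow> (\<exists>\<mu>\<ge>0. quasiconvex_with G S \<mu> H)"

lemma wf_digraph_cayley:
  assumes "group G" "S \<subseteq> carrier G"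
  shows "wf_digraph (cayley G S)"
proof -
  interpret group G by fact
  show ?thesis
    using assms(2) by unfold_locales (auto simp: cayley_def sym_gens_def)
qed

lemma cayley_dist_le_iff:
  assumes "group G" "S \<subseteq> carrier G"
  shows "cayley_dist G S u v \<le> ereal r \<longleftrightarrow>
    (\<exists>p. pre_digraph.awalk (cayley G S) u p v \<and> real (length p) \<le> r)"
proof -
  interpret wf_digraph "cayley G S" using assms by (rule wf_digraph_cayley)
  have cost: "awalk_cost (\<lambda>_. 1) p = real (length p)" for p :: "('a \<times> 'a) list"
    by (induction p) auto
  have D: "cayley_dist G S u v = (INF p\<in>{p. awalk u p v}. ereal (real (length p)))"
    by (simp add: cayley_dist_def \<mu>_def cost)
  show ?thesis
  proof (cases "\<exists>p. awalk u p v")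
    case False
    then show ?thesis by (simp add: D top_ereal_def)
  next
    case True
    then obtain p where p: "awalk u p v" "\<And>q. awalk u q v \<Longrightarrow> length p \<le> length q"
      using ex_has_least_nat[of "\<lambda>p. awalk u p v" _ length] by metis
    have "cayley_dist G S u v = ereal (real (length p))"
      unfolding D using p by (intro antisym INF_lower2[of p] INF_greatest) auto
    then have "cayley_dist G S u v \<le> ereal r \<longleftrightarrow> real (length p) \<le> r" by simp
    then show ?thesis using p by (meson of_nat_mono order_trans)
  qed
qed


section \<open>Amalgamated free products\<close>

text \<open>The free product of \<open>A\<close> and \<open>B\<close> amalgamated along \<open>C\<close>, for homomorphisms
  \<open>i\<close> from \<open>C\<close> to \<open>A\<close> and \<open>j\<close> from \<open>C\<close> to \<open>B\<close>: words in the disjoint union of \<open>A\<close> and \<open>B\<close>,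
  modulo the congruence generated by the multiplication tables and by \<open>i c = j c\<close>.\<close>

definition amalg_words ::
  "('a, 'm) monoid_scheme \<Rightarrow> ('b, 'n) monoid_scheme \<Rightarrow> ('a + 'b) list set" where
  "amalg_words A B = lists (carrier A <+> carrier B)"

inductive_set amalg_rel :: "('a, 'm) monoid_scheme \<Rightarrow> ('b, 'n) monoid_scheme \<Rightarrow>
    ('c, 'k) monoid_scheme \<Rightarrow> ('c \<Rightarrow> 'a) \<Rightarrow> ('c \<Rightarrow> 'b) \<Rightarrow> (('a + 'b) list \<times> ('a + 'b) list) set"
  for A B C i j where
  refl: "w \<in> amalg_words A B \<Longrightarrow> (w, w) \<in> amalg_rel A B C i j"
| sym: "(v, w) \<in> amalg_rel A B C i j \<Longrightarrow> (w, v) \<in> amalg_rel A B C i j"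
| trans: "\<lbrakk>(u, v) \<in> amalg_rel A B C i j; (v, w) \<in> amalg_rel A B C i j\<rbrakk>
    \<Longrightarrow> (u, w) \<in> amalg_rel A B C i j"
| mult_left: "\<lbrakk>u \<in> amalg_words A B; v \<in> amalg_words A B; x \<in> carrier A; y \<in> carrier A\<rbrakk>
    \<Longrightarrow> (u @ [Inl x, Inl y] @ v, u @ [Inl (x \<otimes>\<^bsub>A\<^esub> y)] @ v) \<in> amalg_rel A B C i j"
| mult_right: "\<lbrakk>u \<in> amalg_words A B; v \<in> amalg_words A B; x \<in> carrier B; y \<in> carrier B\<rbrakk>
    \<Longrightarrow> (u @ [Inr x, Inr y] @ v, u @ [Inr (x \<otimes>\<^bsub>B\<^esub> y)] @ v) \<in> amalg_rel A B C i j"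
| one_left: "\<lbrakk>u \<in> amalg_words A B; v \<in> amalg_words A B\<rbrakk>
    \<Longrightarrow> (u @ [Inl \<one>\<^bsub>A\<^esub>] @ v, u @ v) \<in> amalg_rel A B C i j"
| one_right: "\<lbrakk>u \<in> amalg_words A B; v \<in> amalg_words A B\<rbrakk>
    \<Longrightarrow> (u @ [Inr \<one>\<^bsub>B\<^esub>] @ v, u @ v) \<in> amalg_rel A B C i j"
| glue: "\<lbrakk>u \<in> amalg_words A B; v \<in> amalg_words A B; c \<in> carrier C\<rbrakk>
    \<Longrightarrow> (u @ [Inl (i c)] @ v, u @ [Inr (j c)] @ v) \<in> amalg_rel A B C i j"

definition amalgam :: "('a, 'm) monoid_scheme \<Rightarrow> ('b, 'n) monoid_scheme \<Rightarrow>
    ('c, 'k) monoid_scheme \<Rightarrow> ('c \<Rightarrow> 'a) \<Rightarrow> ('c \<Rightarrow> 'b) \<Rightarrow> ('a + 'b) list set monoid" where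
  "amalgam A B C i j =
     \<lparr>carrier = amalg_words A B // amalg_rel A B C i j,
      monoid.mult = (\<lambda>U V. \<Union>u\<in>U. \<Union>v\<in>V. amalg_rel A B C i j `` {u @ v}),
      one = amalg_rel A B C i j `` {[]}\<rparr>"

text \<open>The map on congruence classes of words induced by \<open>f\<close> on \<open>A\<close> and \<open>g\<close> on \<open>B\<close>; it is well
  defined when these agree on \<open>C\<close>, see \<open>amalg_lift_class\<close> below.\<close>

definition amalg_eval ::
  "('g, 'l) monoid_scheme \<Rightarrow> ('a \<Rightarrow> 'g) \<Rightarrow> ('b \<Rightarrow> 'g) \<Rightarrow> ('a + 'b) list \<Rightarrow> 'g" where
  "amalg_eval G f g w = foldr (\<lambda>s z. case_sum f g s \<otimes>\<^bsub>G\<^esub> z) w \<one>\<^bsub>G\<^esub>"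

definition amalg_lift ::
  "('g, 'l) monoid_scheme \<Rightarrow> ('a \<Rightarrow> 'g) \<Rightarrow> ('b \<Rightarrow> 'g) \<Rightarrow> ('a + 'b) list set \<Rightarrow> 'g" where
  "amalg_lift G f g U = the_elem (amalg_eval G f g ` U)"

definition generate_amalgam ::
  "('a, 'm) monoid_scheme \<Rightarrow> 'a set \<Rightarrow> 'a set \<Rightarrow> 'a set \<Rightarrow> bool" where
  "generate_amalgam G A B C \<longleftrightarrow>
     amalg_lift G (\<lambda>x. x) (\<lambda>x. x)
       \<in> iso (amalgam (G\<lparr>carrier := A\<rparr>) (G\<lparr>carrier := B\<rparr>) (G\<lparr>carrier := C\<rparr>) (\<lambda>x. x) (\<lambda>x. x))
             (G\<lparr>carrier := generate G (A \<union> B)\<rparr>)"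

locale amalgam_data =
  A: group A + B: group B + i: group_hom C A i + j: group_hom C B j
  for A :: "('a, 'm) monoid_scheme" and B :: "('b, 'n) monoid_scheme"
    and C :: "('c, 'k) monoid_scheme" and i j
begin

abbreviation "W \<equiv> amalg_words A B"
abbreviation "R \<equiv> amalg_rel A B C i j"

lemma words_append [simp]: "u @ v \<in> W \<longleftrightarrow> u \<in> W \<and> v \<in> W"
  by (auto simp: amalg_words_def)

lemma words_simps [simp]:
  "[] \<in> W"
  "Inl x # u \<in> W \<longleftrightarrow> x \<in> carrier A \<and> u \<in> W"
  "Inr y # u \<in> W \<longleftrightarrow> y \<in> carrier B \<and> u \<in> W"
  by (auto simp: amalg_words_def)

lemma rel_words: "(u, v) \<in> R \<Longrightarrow> u \<in> W \<and> v \<in> W"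
  by (induction rule: amalg_rel.induct) auto

lemma equiv_rel: "equiv W R"
proof (rule equivI)
  show "R \<subseteq> W \<times> W" using rel_words by auto
  show "refl_on W R" using amalg_rel.refl by (auto simp: refl_on_def)
  show "sym R" by (auto intro: symI amalg_rel.sym)
  show "trans R" by (auto intro: transI amalg_rel.trans)
qed

lemma rel_append1:
  assumes "(u, v) \<in> R" "w \<in> W"
  shows "(u @ w, v @ w) \<in> R"
  using assms
proof (induction rule: amalg_rel.induct)
  case (trans u v w')
  then show ?case by (blast intro: amalg_rel.trans)
next
  case (mult_left u v x y)
  then show ?case using amalg_rel.mult_left[of u A B "v @ w" x y C i j] by simp
next
  case (mult_right u v x y)
  then show ?case using amalg_rel.mult_right[of u A B "v @ w" x y C i j] by simp
next
  case (one_left u v)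
  then show ?case using amalg_rel.one_left[of u A B "v @ w" C i j] by simp
next
  case (one_right u v)
  then show ?case using amalg_rel.one_right[of u A B "v @ w" C i j] by simp
next
  case (glue u v c)
  then show ?case using amalg_rel.glue[of u A B "v @ w" c C i j] by simp
qed (simp_all add: amalg_rel.refl amalg_rel.sym)

lemma rel_append2:
  assumes "(u, v) \<in> R" "w \<in> W"
  shows "(w @ u, w @ v) \<in> R"
  using assms
proof (induction rule: amalg_rel.induct)
  case (trans u v w')
  then show ?case by (blast intro: amalg_rel.trans)
next
  case (mult_left u v x y)
  then show ?case using amalg_rel.mult_left[of "w @ u" A B v x y C i j] by simp
next
  case (mult_right u v x y)
  then show ?case using amalg_rel.mult_right[of "w @ u" A B v x y C i j] by simp
next
  case (one_left u v)
  then show ?case using amalg_rel.one_left[of "w @ u" A B v C i j] by simp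
next
  case (one_right u v)
  then show ?case using amalg_rel.one_right[of "w @ u" A B v C i j] by simp
next
  case (glue u v c)
  then show ?case using amalg_rel.glue[of "w @ u" A B v c C i j] by simp
qed (simp_all add: amalg_rel.refl amalg_rel.sym)

lemma rel_append: "\<lbrakk>(u, u') \<in> R; (v, v') \<in> R\<rbrakk> \<Longrightarrow> (u @ v, u' @ v') \<in> R"
  by (rule amalg_rel.trans[OF rel_append1 rel_append2]) (auto dest: rel_words)

lemma mult_class:
  assumes "u \<in> W" "v \<in> W"
  shows "R `` {u} \<otimes>\<^bsub>amalgam A B C i j\<^esub> R `` {v} = R `` {u @ v}"
proof -
  have "congruent2 R R (\<lambda>u v. R `` {u @ v})"
    by (rule congruent2I') (rule equiv_class_eq[OF equiv_rel rel_append])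
  then show ?thesis
    unfolding amalgam_def monoid.simps by (rule UN_equiv_class2[OF equiv_rel equiv_rel _ assms])
qed

fun winv :: "('a + 'b) list \<Rightarrow> ('a + 'b) list" where
  "winv [] = []"
| "winv (Inl x # w) = winv w @ [Inl (inv\<^bsub>A\<^esub> x)]"
| "winv (Inr x # w) = winv w @ [Inr (inv\<^bsub>B\<^esub> x)]"

lemma winv_words: "w \<in> W \<Longrightarrow> winv w \<in> W"
  by (induction w rule: winv.induct) auto

lemma winv_rel: "w \<in> W \<Longrightarrow> (winv w @ w, []) \<in> R"
proof (induction w rule: winv.induct)
  case 1
  then show ?case by (simp add: amalg_rel.refl)
next
  case (2 x w)
  then have *: "winv w \<in> W" "w \<in> W" "x \<in> carrier A" using winv_words by auto
  have "(winv w @ [Inl (inv\<^bsub>A\<^esub> x), Inl x] @ w, winv w @ [Inl \<one>\<^bsub>A\<^esub>] @ w) \<in> R"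
    using amalg_rel.mult_left[of "winv w" A B w "inv\<^bsub>A\<^esub> x" x C i j] * by simp
  then have "(winv w @ [Inl (inv\<^bsub>A\<^esub> x), Inl x] @ w, []) \<in> R"
    using amalg_rel.one_left[OF *(1,2)] 2(1)[OF *(2)] by (blast intro: amalg_rel.trans)
  then show ?case by simp
next
  case (3 x w)
  then have *: "winv w \<in> W" "w \<in> W" "x \<in> carrier B" using winv_words by auto
  have "(winv w @ [Inr (inv\<^bsub>B\<^esub> x), Inr x] @ w, winv w @ [Inr \<one>\<^bsub>B\<^esub>] @ w) \<in> R"
    using amalg_rel.mult_right[of "winv w" A B w "inv\<^bsub>B\<^esub> x" x C i j] * by simp
  then have "(winv w @ [Inr (inv\<^bsub>B\<^esub> x), Inr x] @ w, []) \<in> R"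
    using amalg_rel.one_right[OF *(1,2)] 3(1)[OF *(2)] by (blast intro: amalg_rel.trans)
  then show ?case by simp
qed

lemma carrier_amalgam: "carrier (amalgam A B C i j) = W // R"
  by (simp add: amalgam_def)

lemma one_amalgam: "\<one>\<^bsub>amalgam A B C i j\<^esub> = R `` {[]}"
  by (simp add: amalgam_def)

lemma group_amalgam: "group (amalgam A B C i j)"
proof (rule groupI)
  show "\<exists>y\<in>carrier (amalgam A B C i j). y \<otimes>\<^bsub>amalgam A B C i j\<^esub> U = \<one>\<^bsub>amalgam A B C i j\<^esub>"
    if U: "U \<in> carrier (amalgam A B C i j)" for U
  proof -
    obtain w where w: "w \<in> W" "U = R `` {w}"
      by (rule quotientE[OF U[unfolded carrier_amalgam]])
    have "R `` {winv w} \<otimes>\<^bsub>amalgam A B C i j\<^esub> U = \<one>\<^bsub>amalgam A B C i j\<^esub>"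
      unfolding w(2) one_amalgam using w(1) winv_words winv_rel
      by (simp add: mult_class equiv_class_eq[OF equiv_rel])
    then show ?thesis using w winv_words by (metis carrier_amalgam quotientI)
  qed
qed (auto simp: carrier_amalgam one_amalgam mult_class quotientI elim!: quotientE)

lemma amalg_lift_class:
  assumes "group G" "f \<in> hom A G" "g \<in> hom B G" "\<And>c. c \<in> carrier C \<Longrightarrow> f (i c) = g (j c)"
    and "w \<in> W"
  shows "amalg_lift G f g (R `` {w}) = amalg_eval G f g w"
proof -
  interpret G: group G by fact
  interpret f: group_hom A G f by unfold_locales fact
  interpret g: group_hom B G g by unfold_locales fact
  have cl: "amalg_eval G f g u \<in> carrier G" if "u \<in> W" for u
    using that
  proof (induction u)
    case (Cons s u) then show ?case by (cases s) (auto simp: amalg_eval_def)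
  qed (simp add: amalg_eval_def)
  have app: "amalg_eval G f g (u @ v) = amalg_eval G f g u \<otimes>\<^bsub>G\<^esub> amalg_eval G f g v"
    if "u \<in> W" "v \<in> W" for u v
    using that
  proof (induction u)
    case Nil then show ?case using cl[of v] by (simp add: amalg_eval_def)
  next
    case (Cons s u) then show ?case using cl[of u] cl[of v]
      by (cases s) (auto simp: amalg_eval_def G.m_assoc)
  qed
  have Cons: "amalg_eval G f g (s # u) = case_sum f g s \<otimes>\<^bsub>G\<^esub> amalg_eval G f g u" for s u
    by (simp add: amalg_eval_def)
  have "amalg_eval G f g u = amalg_eval G f g v" if "(u, v) \<in> R" for u v
    using that
    by (induction rule: amalg_rel.induct) (auto simp: app Cons cl G.m_assoc assms(4))
  then have "amalg_eval G f g ` (R `` {w}) = {amalg_eval G f g w}"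
    using amalg_rel.refl[OF assms(5)] by fastforce
  then show ?thesis by (simp add: amalg_lift_def)
qed

end

end

theory Submission
  imports Defs
begin

text \<open>Thin triangles give Gromov's four-point inequality. If \<open>a \<in> H\<close> is shortest in \<open>a (H \<inter> K)\<close> and
  \<open>b \<in> K\<close>, then the Gromov product of \<open>a\<inverse>\<close> and \<open>b\<close> at \<open>\<one>\<close> is bounded by a constant that depends
  only on \<open>\<mu>\<close> and the group: otherwise the pigeonhole principle yields an element of \<open>H \<inter> K\<close> that
  shortens \<open>a\<close>. An alternating word in \<open>H\<^sub>1\<close> and \<open>K\<^sub>1\<close> can be rewritten so that all letters but the
  last are shortest in their cosets. Its partial products then form a broken geodesic whose
  pieces are long compared to the Gromov products at the breaks, so its ends are distinct, which
  shows that the homomorphism from the amalgam is injective. Moreover a geodesic between the ends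
  stays close to the breaks and to the pieces, which gives quasiconvexity.\<close>

section \<open>Broken geodesics in hyperbolic spaces\<close>

text \<open>Hyperbolicity is stated through Gromov products, so that the estimates on broken
  geodesics do not refer to paths. The products at \<open>w\<close> are written out in
  \<open>four_point\<close> because \<open>gromov\<close> is only defined inside the locale.\<close>

locale four_point_space =
  fixes X :: "'a set" and d :: "'a \<Rightarrow> 'a \<Rightarrow> real" and D :: real
  assumes self: "x \<in> X \<Longrightarrow> d x x = 0"
    and commute: "x \<in> X \<Longrightarrow> y \<in> X \<Longrightarrow> d x y = d y x"
    and nonneg: "0 \<le> d x y"
    and triangle: "x \<in> X \<Longrightarrow> y \<in> X \<Longrightarrow> z \<in> X \<Longrightarrow> d x z \<le> d x y + d y z"
    and D_nonneg: "0 \<le> D"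
    and four_point: "x \<in> X \<Longrightarrow> y \<in> X \<Longrightarrow> z \<in> X \<Longrightarrow> w \<in> X \<Longrightarrow>
      min ((d w x + d w y - d x y) / 2) ((d w y + d w z - d y z) / 2)
        \<le> (d w x + d w z - d x z) / 2 + D"
begin

text \<open>The Gromov product of \<open>x\<close> and \<open>y\<close>; the base point
  \<open>w\<close> comes last.\<close>

definition gromov :: "'a \<Rightarrow> 'a \<Rightarrow> 'a \<Rightarrow> real" where
  "gromov x y w = (d w x + d w y - d x y) / 2"

lemma gromov_four_point:
  "\<lbrakk>x \<in> X; y \<in> X; z \<in> X; w \<in> X\<rbrakk> \<Longrightarrow> gromov x y w \<le> gromov x z w + D \<or> gromov y z w \<le> gromov x z w + D"
  using four_point[of x y z w] by (auto simp: gromov_def min_le_iff_disj)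

lemma gromov_commute: "x \<in> X \<Longrightarrow> y \<in> X \<Longrightarrow> gromov x y w = gromov y x w"
  by (simp add: gromov_def commute)

lemma gromov_le_dist:
  assumes "x \<in> X" "y \<in> X" "w \<in> X" shows "gromov x y w \<le> d w x" "gromov x y w \<le> d w y"
  using triangle[of w x y] triangle[of w y x] assms commute by (auto simp: gromov_def)

text \<open>The products of \<open>u\<close> with \<open>x\<close> and of \<open>v\<close> with
  \<open>y\<close> at \<open>b\<close> equal \<open>t\<close>, so two four-point inequalities along
  \<open>u\<close>, \<open>x\<close>, \<open>y\<close>, \<open>v\<close> make the product of
  \<open>u\<close> and \<open>v\<close> at least \<open>t - 2 * D\<close>. As both points are at
  distance \<open>t\<close> from \<open>b\<close>, this bounds \<open>d u v\<close>.\<close>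

lemma geodesics_fellow_travel:
  assumes X: "b \<in> X" "x \<in> X" "y \<in> X" "u \<in> X" "v \<in> X"
    and u: "d b u = t" "d b u + d u x = d b x" and v: "d b v = t" "d b v + d v y = d b y"
    and t: "t \<le> gromov x y b"
  shows "d u v \<le> 4 * D"
proof -
  have "gromov u x b = t" "gromov y v b = t"
    using u v X by (auto simp: gromov_def commute)
  moreover have "gromov u x b \<le> gromov u y b + D \<or> gromov x y b \<le> gromov u y b + D"
    "gromov u y b \<le> gromov u v b + D \<or> gromov y v b \<le> gromov u v b + D"
    using gromov_four_point X by auto
  ultimately have "t \<le> gromov u v b + 2 * D"
    using t D_nonneg by linarith
  then show ?thesis by (simp add: gromov_def u v field_simps)
qed

text \<open>Here \<open>n\<close> counts the pieces. Their length \<open>2 * M + 3 * D + 1\<close>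
  absorbs a product of at most \<open>M + D\<close> at one end of a piece and still leaves more than
  \<open>M + 2 * D\<close> at the other.\<close>

definition broken_geodesic :: "real \<Rightarrow> (nat \<Rightarrow> 'a) \<Rightarrow> nat \<Rightarrow> bool" where
  "broken_geodesic M x n \<longleftrightarrow> (\<forall>i\<le>n. x i \<in> X) \<and>
     (\<forall>i<n. d (x i) (x (Suc i)) \<ge> 2 * M + 3 * D + 1) \<and>
     (\<forall>i. Suc (Suc i) \<le> n \<longrightarrow> gromov (x i) (x (Suc (Suc i))) (x (Suc i)) \<le> M)"

lemma broken_geodesic_rev:
  assumes "broken_geodesic M x n" shows "broken_geodesic M (\<lambda>i. x (n - i)) n"
  unfolding broken_geodesic_def
proof (intro conjI allI impI)
  show "x (n - i) \<in> X" if "i \<le> n" for i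
    using assms by (simp add: broken_geodesic_def)
  show "2 * M + 3 * D + 1 \<le> d (x (n - i)) (x (n - Suc i))" if "i < n" for i
  proof -
    have "Suc (n - Suc i) = n - i" "n - Suc i < n" using that by auto
    then show ?thesis using assms commute unfolding broken_geodesic_def
      by (metis Suc_leI less_imp_le_nat)
  qed
  show "gromov (x (n - i)) (x (n - Suc (Suc i))) (x (n - Suc i)) \<le> M" if "Suc (Suc i) \<le> n" for i
  proof -
    have *: "Suc (n - Suc (Suc i)) = n - Suc i" "Suc (Suc (n - Suc (Suc i))) = n - i"
      using that by auto
    then have "gromov (x (n - Suc (Suc i))) (x (n - i)) (x (n - Suc i)) \<le> M"
      using assms unfolding broken_geodesic_def by (metis diff_le_self)
    moreover have "x (n - Suc (Suc i)) \<in> X" "x (n - i) \<in> X"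
      using assms by (auto simp: broken_geodesic_def)
    ultimately show ?thesis by (simp add: gromov_commute)
  qed
qed

text \<open>Induction along the breaks: seen from \<open>x (Suc i)\<close>, the points
  \<open>x 0\<close> and \<open>x i\<close> have a large product, because the one at
  \<open>x i\<close> is small and the piece is long. Hence the four-point inequality carries the
  bound \<open>M\<close> over from \<open>x i\<close> to \<open>x 0\<close>, and the loss
  \<open>D\<close> does not accumulate.\<close>

lemma broken_geodesic_gromov_start:
  assumes b: "broken_geodesic M x n" and "M \<ge> 0" and "i < n"
  shows "gromov (x 0) (x (Suc i)) (x i) \<le> M + D"
  using \<open>i < n\<close>
proof (induction i)
  case 0
  then show ?case using b \<open>M \<ge> 0\<close> D_nonneg
    by (auto simp: gromov_def self broken_geodesic_def)
next
  case (Suc i)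
  have X: "x 0 \<in> X" "x i \<in> X" "x (Suc i) \<in> X" "x (Suc (Suc i)) \<in> X"
    using b Suc.prems by (auto simp: broken_geodesic_def)
  have L: "d (x i) (x (Suc i)) \<ge> 2 * M + 3 * D + 1"
    and M: "gromov (x i) (x (Suc (Suc i))) (x (Suc i)) \<le> M"
    using b Suc.prems by (auto simp: broken_geodesic_def)
  \<comment> \<open>The products with a third point at the two ends of a segment add up to its
    length.\<close>
  have "gromov (x i) (x 0) (x (Suc i)) = d (x i) (x (Suc i)) - gromov (x 0) (x (Suc i)) (x i)"
    using X by (simp add: gromov_def commute field_simps)
  also have "\<dots> > M + D"
    using Suc L D_nonneg \<open>M \<ge> 0\<close> by simp
  finally show ?case
    using gromov_four_point[OF X(2,1,4,3)] M by linarith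
qed

text \<open>The last piece has length at least \<open>2 * M + 3 * D + 1\<close>, and a product of at
  most \<open>M + D\<close> at its start cancels at most \<open>2 * M + 2 * D\<close> of it.\<close>

lemma broken_geodesic_dist_pos:
  assumes b: "broken_geodesic M x n" and "M \<ge> 0" and "n > 0"
  shows "d (x 0) (x n) > 0"
proof -
  obtain i where i: "n = Suc i" using \<open>n > 0\<close> gr0_implies_Suc by blast
  have X: "x 0 \<in> X" "x i \<in> X" "x n \<in> X"
    using b i by (auto simp: broken_geodesic_def)
  have "gromov (x 0) (x n) (x i) \<le> M + D"
    using broken_geodesic_gromov_start[OF assms(1,2)] i by simp
  moreover have "d (x i) (x n) \<ge> 2 * M + 3 * D + 1"
    using b i by (auto simp: broken_geodesic_def)
  ultimately show ?thesis
    using X nonneg[of "x i" "x 0"] D_nonneg by (simp add: gromov_def field_simps)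
qed

text \<open>Seen from an inner break, the start and the preceding break have a product above
  \<open>M + 2 * D\<close>, while the preceding break and the end have one of at most
  \<open>M + D\<close>. The four-point inequality then bounds the product of the two ends.\<close>

lemma broken_geodesic_gromov_ends:
  assumes b: "broken_geodesic M x n" and "M \<ge> 0" and "i \<le> n"
  shows "gromov (x 0) (x n) (x i) \<le> M + 2 * D"
proof (cases "i = 0 \<or> i = n")
  case True
  then show ?thesis
    using b \<open>M \<ge> 0\<close> D_nonneg by (auto simp: gromov_def self commute broken_geodesic_def)
next
  case False
  then obtain j where i: "i = Suc j" and "i < n" using \<open>i \<le> n\<close> by (cases i) auto
  then have X: "x 0 \<in> X" "x j \<in> X" "x i \<in> X" "x n \<in> X"
    using b by (auto simp: broken_geodesic_def)
  \<comment> \<open>In the reversed path \<open>x i\<close> has index \<open>n - i\<close>, and its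
    successor is \<open>x j\<close>.\<close>
  have "gromov (x n) (x j) (x i) \<le> M + D"
    using broken_geodesic_gromov_start[OF broken_geodesic_rev[OF b] \<open>M \<ge> 0\<close>, of "n - i"] i \<open>i < n\<close>
    by (simp add: Suc_diff_Suc)
  moreover have "gromov (x j) (x 0) (x i) = d (x j) (x i) - gromov (x 0) (x i) (x j)"
    using X by (simp add: gromov_def commute field_simps)
  moreover have "gromov (x 0) (x i) (x j) \<le> M + D"
    using broken_geodesic_gromov_start[OF b \<open>M \<ge> 0\<close>, of j] i \<open>i < n\<close> by simp
  moreover have "d (x j) (x i) \<ge> 2 * M + 3 * D + 1"
    using b i \<open>i < n\<close> by (auto simp: broken_geodesic_def)
  moreover have "gromov (x j) (x n) (x i) = gromov (x n) (x j) (x i)"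
    using X gromov_commute by blast
  ultimately show ?thesis
    using gromov_four_point[OF X(2,1,4,3)] by linarith
qed

text \<open>At \<open>p\<close> the two ends have product 0. Just before the first break whose
  product with the start is small lies a break whose product with the end is small. So the piece
  between these breaks passes near \<open>p\<close>, or the later break has small products with both
  ends and is itself near \<open>p\<close>.\<close>

lemma broken_geodesic_shadow:
  assumes b: "broken_geodesic M x n" and "M \<ge> 0"
    and p: "p \<in> X" "d (x 0) p + d p (x n) = d (x 0) (x n)"
  shows "\<exists>i\<le>n. d (x i) p \<le> M + 5 * D \<or> i < n \<and> gromov (x i) (x (Suc i)) p \<le> 2 * D"
proof -
  have X: "\<And>i. i \<le> n \<Longrightarrow> x i \<in> X" using b by (auto simp: broken_geodesic_def)
  have p0: "gromov (x 0) (x n) p = 0"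
    using p X by (simp add: gromov_def commute)
  text \<open>The break where the shadow of \<open>x i\<close> on the geodesic from \<open>x 0\<close> to \<open>x n\<close> first passes \<open>p\<close>.\<close>
  define i where "i = (LEAST i. gromov (x 0) (x i) p \<le> D)"
  have i: "gromov (x 0) (x i) p \<le> D" unfolding i_def
    by (rule LeastI[of _ n]) (simp add: p0 D_nonneg)
  have "i \<le> n" unfolding i_def by (rule Least_le) (simp add: p0 D_nonneg)
  show ?thesis
  proof (cases i)
    case 0
    then have "d (x 0) p \<le> D" using i X[of 0] p(1) by (simp add: gromov_def self commute)
    then show ?thesis using \<open>M \<ge> 0\<close> D_nonneg by (intro exI[of _ 0]) auto
  next
    case (Suc j)
    have Xi: "x 0 \<in> X" "x j \<in> X" "x i \<in> X" "x n \<in> X" using X Suc \<open>i \<le> n\<close> by auto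
    have "j < (LEAST i. gromov (x 0) (x i) p \<le> D)" using Suc unfolding i_def by simp
    then have j: "gromov (x 0) (x j) p > D" using not_less_Least by fastforce
    then have jn: "gromov (x j) (x n) p \<le> D"
      using gromov_four_point[OF Xi(1,2,4) p(1)] p0 by linarith
    show ?thesis
    proof (cases "gromov (x j) (x i) p \<le> 2 * D")
      case True
      then show ?thesis using Suc \<open>i \<le> n\<close> by (intro exI[of _ j]) auto
    next
      case False
      then have "gromov (x i) (x n) p \<le> 2 * D"
        using gromov_four_point[OF Xi(2,3,4) p(1)] jn by linarith
      moreover have "gromov (x 0) (x n) (x i) \<le> M + 2 * D"
        using broken_geodesic_gromov_ends[OF b \<open>M \<ge> 0\<close> \<open>i \<le> n\<close>] .
      moreover have "d (x i) p = gromov (x i) (x n) p + gromov (x 0) (x i) p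
          + gromov (x 0) (x n) (x i) - gromov (x 0) (x n) p"
        using Xi p(1) by (simp add: gromov_def commute field_simps)
      ultimately have "d (x i) p \<le> M + 5 * D" using i p0 by linarith
      then show ?thesis using \<open>i \<le> n\<close> by blast
    qed
  qed
qed

end

section \<open>The word metric\<close>

locale cayley_group = group G for G (structure) +
  fixes S :: "'a set"
  assumes S_closed: "S \<subseteq> carrier G" and S_generate: "generate G S = carrier G"
begin

sublocale cay: wf_digraph "cayley G S"
  by (rule wf_digraph_cayley[OF is_group S_closed])

lemma cayley_sel [simp]:
  "verts (cayley G S) = carrier G" "arcs (cayley G S) = carrier G \<times> sym_gens G S"
  "tail (cayley G S) e = fst e" "head (cayley G S) e = fst e \<otimes> snd e"
  by (auto simp: cayley_def split: prod.split)

section \<open>Words in the generators\<close>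

abbreviation word_prod :: "'a list \<Rightarrow> 'a" where
  "word_prod w \<equiv> foldr (\<otimes>) w \<one>"

lemma sym_gens_closed: "sym_gens G S \<subseteq> carrier G"
  using S_closed by (auto simp: sym_gens_def)

lemma word_prod_closed: "set w \<subseteq> carrier G \<Longrightarrow> word_prod w \<in> carrier G"
  by (induction w) auto

lemma word_prod_append:
  "set v \<subseteq> carrier G \<Longrightarrow> set w \<subseteq> carrier G \<Longrightarrow> word_prod (v @ w) = word_prod v \<otimes> word_prod w"
  by (induction v) (auto simp: word_prod_closed m_assoc)

lemma inv_sym_gens: "x \<in> sym_gens G S \<Longrightarrow> inv x \<in> sym_gens G S"
  using S_closed by (auto simp: sym_gens_def)

lemma word_prod_inv:
  assumes "set w \<subseteq> sym_gens G S"
  shows "word_prod (rev (map (\<lambda>x. inv x) w)) = inv (word_prod w)"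
  using assms
proof (induction w)
  case (Cons x w)
  then have "set (rev (map (\<lambda>x. inv x) w)) \<subseteq> carrier G" "x \<in> carrier G" "set w \<subseteq> carrier G"
    using sym_gens_closed by auto
  then show ?case using Cons word_prod_append[of "rev (map (\<lambda>x. inv x) w)" "[inv x]"]
    by (simp add: inv_mult_group word_prod_closed)
qed auto

lemma word_prod_exists:
  assumes "g \<in> carrier G" shows "\<exists>w. set w \<subseteq> sym_gens G S \<and> word_prod w = g"
proof -
  have "g \<in> generate G S" using assms S_generate by simp
  then show ?thesis
  proof induction
    case one
    show ?case by (rule exI[of _ "[]"]) simp
  next
    case (incl h)
    then show ?case using S_closed by (intro exI[of _ "[h]"]) (auto simp: sym_gens_def)
  next
    case (inv h)
    then show ?case using S_closed by (intro exI[of _ "[inv h]"]) (auto simp: sym_gens_def)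
  next
    case (eng g h)
    then obtain v w where "set v \<subseteq> sym_gens G S" "word_prod v = g"
      "set w \<subseteq> sym_gens G S" "word_prod w = h" by blast
    then show ?case using word_prod_append[of v w] sym_gens_closed
      by (intro exI[of _ "v @ w"]) (auto dest: subset_trans)
  qed
qed

lemma word_length_le: "set w \<subseteq> sym_gens G S \<Longrightarrow> word_length G S (word_prod w) \<le> length w"
  unfolding word_length_def by (rule Least_le) blast

lemma word_length_witness:
  assumes "g \<in> carrier G"
  obtains w where "set w \<subseteq> sym_gens G S" "word_prod w = g" "length w = word_length G S g"
proof -
  have "\<exists>n w. set w \<subseteq> sym_gens G S \<and> length w = n \<and> word_prod w = g"
    using word_prod_exists[OF assms] by blast
  from LeastI_ex[OF this] show thesis using that unfolding word_length_def by blast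
qed

lemma word_length_one: "word_length G S \<one> = 0"
  using word_length_le[of "[]"] by simp

lemma word_length_mult:
  assumes "g \<in> carrier G" "h \<in> carrier G"
  shows "word_length G S (g \<otimes> h) \<le> word_length G S g + word_length G S h"
proof -
  obtain v w where "set v \<subseteq> sym_gens G S" "word_prod v = g" "length v = word_length G S g"
      "set w \<subseteq> sym_gens G S" "word_prod w = h" "length w = word_length G S h"
    using word_length_witness assms by metis
  then show ?thesis using word_length_le[of "v @ w"] word_prod_append[of v w] sym_gens_closed
    by (auto dest: subset_trans)
qed

lemma word_length_inv_le:
  assumes "g \<in> carrier G" shows "word_length G S (inv g) \<le> word_length G S g"
proof -
  obtain w where w: "set w \<subseteq> sym_gens G S" "word_prod w = g" "length w = word_length G S g"
    using word_length_witness assms by metis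
  then have "set (rev (map (\<lambda>x. inv x) w)) \<subseteq> sym_gens G S" using inv_sym_gens by auto
  from word_length_le[OF this] show ?thesis using w word_prod_inv by auto
qed

lemma word_length_inv: "g \<in> carrier G \<Longrightarrow> word_length G S (inv g) = word_length G S g"
  using word_length_inv_le[of g] word_length_inv_le[of "inv g"] by simp

text \<open>Elements of a ball are products of boundedly long words over a finite alphabet. This
  feeds the pigeonhole argument below.\<close>

lemma finite_word_length_le:
  assumes "finite S" shows "finite {g \<in> carrier G. real (word_length G S g) \<le> r}"
proof -
  have "finite (word_prod ` {w. set w \<subseteq> sym_gens G S \<and> length w \<le> nat \<lfloor>r\<rfloor>})"
    using assms by (intro finite_imageI finite_lists_length_le) (simp add: sym_gens_def)
  moreover have "{g \<in> carrier G. real (word_length G S g) \<le> r}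
      \<subseteq> word_prod ` {w. set w \<subseteq> sym_gens G S \<and> length w \<le> nat \<lfloor>r\<rfloor>}"
  proof safe
    fix g assume g: "g \<in> carrier G" "real (word_length G S g) \<le> r"
    obtain w where w: "set w \<subseteq> sym_gens G S" "word_prod w = g" "length w = word_length G S g"
      using word_length_witness g by metis
    then have "length w \<le> nat \<lfloor>r\<rfloor>" using g(2) by linarith
    then show "g \<in> word_prod ` {w. set w \<subseteq> sym_gens G S \<and> length w \<le> nat \<lfloor>r\<rfloor>}" using w by auto
  qed
  ultimately show ?thesis by (rule finite_subset[rotated])
qed

text \<open>The left-invariant word metric, real valued unlike \<open>cayley_dist\<close>;
  neighborhoods and geodesics of the Cayley graph are translated to it below.\<close>

definition wdist :: "'a \<Rightarrow> 'a \<Rightarrow> real" where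
  "wdist u v = real (word_length G S (inv u \<otimes> v))"

lemma wdist_self: "u \<in> carrier G \<Longrightarrow> wdist u u = 0"
  by (simp add: wdist_def word_length_one)

lemma wdist_nonneg: "0 \<le> wdist u v"
  by (simp add: wdist_def)

lemma wdist_one: "u \<in> carrier G \<Longrightarrow> wdist \<one> u = real (word_length G S u)"
  by (simp add: wdist_def)

lemma wdist_commute: "u \<in> carrier G \<Longrightarrow> v \<in> carrier G \<Longrightarrow> wdist u v = wdist v u"
  using word_length_inv[of "inv u \<otimes> v"] by (simp add: wdist_def inv_mult_group)

lemma wdist_triangle:
  assumes "u \<in> carrier G" "v \<in> carrier G" "w \<in> carrier G"
  shows "wdist u w \<le> wdist u v + wdist v w"
proof -
  have "(inv u \<otimes> v) \<otimes> (inv v \<otimes> w) = inv u \<otimes> w"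
    using assms by (metis inv_closed inv_solve_left m_assoc m_closed)
  then show ?thesis using word_length_mult[of "inv u \<otimes> v" "inv v \<otimes> w"] assms
    by (simp add: wdist_def flip: of_nat_add)
qed

lemma wdist_left_invariant:
  assumes "g \<in> carrier G" "u \<in> carrier G" "v \<in> carrier G"
  shows "wdist (g \<otimes> u) (g \<otimes> v) = wdist u v"
proof -
  have "inv (g \<otimes> u) \<otimes> (g \<otimes> v) = inv u \<otimes> v"
    using assms by (simp add: inv_mult_group m_assoc inv_solve_left')
  then show ?thesis by (simp add: wdist_def)
qed

section \<open>Walks and geodesics in terms of the word metric\<close>

lemma awalk_wdist_le:
  assumes "cay.awalk u p v" shows "wdist u v \<le> real (length p)"
  using assms
proof (induction p arbitrary: u)
  case Nil
  then show ?case by (auto simp: cay.awalk_Nil_iff wdist_self)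
next
  case (Cons e p)
  obtain g s where e: "e = (g, s)" by fastforce
  then have u: "g = u" "u \<in> carrier G" "s \<in> sym_gens G S" and p: "cay.awalk (u \<otimes> s) p v"
    using Cons.prems by (auto simp: cay.awalk_Cons_iff)
  have v: "v \<in> carrier G" using cay.awalk_last_in_verts[OF p] by (simp)
  have s: "s \<in> carrier G" using u sym_gens_closed by auto
  have "wdist u (u \<otimes> s) = real (word_length G S s)"
    using u s by (simp add: wdist_def flip: m_assoc)
  also have "\<dots> \<le> 1" using word_length_le[of "[s]"] u s by auto
  finally show ?case using Cons.IH[OF p] wdist_triangle[of u "u \<otimes> s" v] u s v by simp
qed

lemma awalk_of_word:
  assumes "u \<in> carrier G" "set w \<subseteq> sym_gens G S"
  shows "\<exists>p. cay.awalk u p (u \<otimes> word_prod w) \<and> length p = length w"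
  using assms
proof (induction w arbitrary: u)
  case Nil
  then show ?case by (intro exI[of _ "[]"]) (auto simp: cay.awalk_Nil_iff)
next
  case (Cons s w)
  then have s: "s \<in> carrier G" "set w \<subseteq> carrier G" using sym_gens_closed by auto
  obtain p where p: "cay.awalk (u \<otimes> s) p ((u \<otimes> s) \<otimes> word_prod w)" "length p = length w"
    using Cons.IH[of "u \<otimes> s"] Cons.prems s by auto
  then have "cay.awalk u ((u, s) # p) ((u \<otimes> s) \<otimes> word_prod w)"
    using Cons.prems by (auto simp: cay.awalk_Cons_iff)
  then show ?case using p(2) s Cons.prems(1)
    by (intro exI[of _ "(u, s) # p"]) (simp add: m_assoc word_prod_closed)
qed

lemma awalk_wdist_exists:
  assumes "u \<in> carrier G" "v \<in> carrier G"
  shows "\<exists>p. cay.awalk u p v \<and> real (length p) = wdist u v"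
proof -
  obtain w where "set w \<subseteq> sym_gens G S" "word_prod w = inv u \<otimes> v"
      "length w = word_length G S (inv u \<otimes> v)"
    using word_length_witness[of "inv u \<otimes> v"] assms by auto
  then show ?thesis using awalk_of_word[of u w] assms by (simp add: wdist_def flip: m_assoc)
qed

lemma awalk_carrier: "cay.awalk u p v \<Longrightarrow> u \<in> carrier G \<and> v \<in> carrier G"
  using cay.awalk_hd_in_verts cay.awalk_last_in_verts by simp

lemma cayley_dist_le_iff_wdist:
  assumes "u \<in> carrier G" "v \<in> carrier G"
  shows "cayley_dist G S u v \<le> ereal r \<longleftrightarrow> wdist u v \<le> r"
proof -
  obtain p where p: "cay.awalk u p v" "real (length p) = wdist u v"
    using awalk_wdist_exists[OF assms] by blast
  show ?thesis unfolding cayley_dist_le_iff[OF is_group S_closed]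
    using p awalk_wdist_le order_trans by metis
qed

lemma nbhd_iff:
  assumes "T \<subseteq> carrier G"
  shows "v \<in> nbhd G S r T \<longleftrightarrow> v \<in> carrier G \<and> (\<exists>t\<in>T. wdist t v \<le> r)"
proof -
  have "cayley_dist G S t v \<le> ereal r \<longleftrightarrow> wdist t v \<le> r" if "v \<in> carrier G" "t \<in> T" for t
    using that assms cayley_dist_le_iff_wdist by blast
  then show ?thesis by (auto simp: nbhd_def)
qed

lemma geodesic_iff: "geodesic G S u p v \<longleftrightarrow> cay.awalk u p v \<and> real (length p) = wdist u v"
proof
  assume "geodesic G S u p v"
  then have p: "cay.awalk u p v" "\<And>q. cay.awalk u q v \<Longrightarrow> length p \<le> length q"
    by (auto simp: geodesic_def)
  obtain q where "cay.awalk u q v" "real (length q) = wdist u v"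
    using awalk_wdist_exists awalk_carrier[OF p(1)] by blast
  then show "cay.awalk u p v \<and> real (length p) = wdist u v"
    using p awalk_wdist_le[OF p(1)] by (metis of_nat_mono order_antisym)
next
  assume "cay.awalk u p v \<and> real (length p) = wdist u v"
  then show "geodesic G S u p v"
    using awalk_wdist_le unfolding geodesic_def by (metis of_nat_le_iff)
qed

lemma geodesic_exists: "u \<in> carrier G \<Longrightarrow> v \<in> carrier G \<Longrightarrow> \<exists>p. geodesic G S u p v"
  using awalk_wdist_exists geodesic_iff by auto

lemma path_verts_closed:
  assumes "cay.awalk u p v" shows "path_verts G S u p \<subseteq> carrier G"
  using assms unfolding path_verts_def by (auto elim!: cay.awalkE)

lemma ends_path_verts:
  assumes "cay.awalk u p v" shows "u \<in> path_verts G S u p" "v \<in> path_verts G S u p"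
  using assms unfolding path_verts_def
  by (metis cay.awhd_of_awalk hd_in_set cay.awalk_verts_non_Nil)
    (metis assms cay.awalkE last_in_set cay.awalk_verts_non_Nil)

lemma geodesic_closed:
  assumes "geodesic G S u p v"
  shows "u \<in> carrier G" "v \<in> carrier G" "path_verts G S u p \<subseteq> carrier G"
  using awalk_carrier[of u p v] path_verts_closed[of u p v] assms by (simp_all add: geodesic_iff)

text \<open>Neither part is shorter than the distance between its ends, and the triangle inequality
  bounds the sum of these distances below by the total length, so equality holds throughout.\<close>

lemma geodesic_split:
  assumes "real (length (q @ r)) = wdist u v" "cay.awalk u q x" "cay.awalk x r v"
  shows "wdist u x = real (length q)" "wdist u x + wdist x v = wdist u v"
  using assms awalk_wdist_le[OF assms(2)] awalk_wdist_le[OF assms(3)]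
    wdist_triangle[of u x v] awalk_carrier by fastforce+

lemma geodesic_between:
  assumes "geodesic G S u p v" "x \<in> path_verts G S u p"
  shows "wdist u x + wdist x v = wdist u v"
proof -
  obtain q r where "p = q @ r" "cay.awalk u q x" "cay.awalk x r v"
    using cay.awalk_decomp[of u p v x] assms by (auto simp: geodesic_iff path_verts_def)
  then show ?thesis using geodesic_split assms(1) geodesic_iff by blast
qed

lemma geodesic_point:
  assumes "geodesic G S u p v" "real t \<le> wdist u v"
  obtains x where "x \<in> path_verts G S u p" "x \<in> carrier G" "wdist u x = t"
    "wdist u x + wdist x v = wdist u v"
proof -
  have p: "cay.awalk u p v" "real (length p) = wdist u v" using assms geodesic_iff by auto
  define x where "x = cay.awlast u (take t p)"
  have "cay.awalk u (take t p @ drop t p) v" using p by simp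
  then have *: "cay.awalk u (take t p) x" "cay.awalk x (drop t p) v"
    unfolding cay.awalk_append_iff x_def by auto
  have "t \<le> length p" using p assms by simp
  then have "wdist u x = t" "wdist u x + wdist x v = wdist u v"
    using geodesic_split[OF _ *] p by auto
  moreover have "x \<in> set (cay.awalk_verts u (take t p @ drop t p))"
    using cay.awalk_verts_append[OF \<open>cay.awalk u (take t p @ drop t p) v\<close>] ends_path_verts(2)[OF *(1)]
    by (auto simp: path_verts_def)
  ultimately show thesis using that awalk_carrier[OF *(1)] by (simp add: path_verts_def)
qed

text \<open>Stands in for the connectedness of a path: the change from \<open>P\<close> to
  \<open>Q\<close> happens at one vertex or across one edge.\<close>

lemma awalk_transition:
  assumes "cay.awalk u p v" "P u" "Q v" "\<And>x. x \<in> path_verts G S u p \<Longrightarrow> P x \<or> Q x"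
  shows "\<exists>x\<in>path_verts G S u p. \<exists>y\<in>path_verts G S u p. P x \<and> Q y \<and> wdist x y \<le> 1"
  using assms
proof (induction p arbitrary: u)
  case Nil
  then show ?case by (auto simp: path_verts_def cay.awalk_Nil_iff wdist_self)
next
  case (Cons e p)
  let ?u' = "head (cayley G S) e"
  have e: "tail (cayley G S) e = u" and p: "cay.awalk ?u' p v"
    using Cons.prems(1) by (auto simp: cay.awalk_Cons_iff)
  have verts: "path_verts G S u (e # p) = insert u (path_verts G S ?u' p)"
    using e by (simp add: path_verts_def)
  have "cay.awalk u [e] ?u'"
    using Cons.prems(1) p cay.awalk_hd_in_verts by (auto simp: cay.awalk_Cons_iff cay.awalk_Nil_iff)
  from awalk_wdist_le[OF this] have d: "wdist u ?u' \<le> 1" by simp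
  have u': "?u' \<in> path_verts G S ?u' p" using ends_path_verts(1)[OF p] .
  show ?case
  proof (cases "Q ?u'")
    case True
    then show ?thesis unfolding verts
      by (intro bexI[of _ u] bexI[of _ ?u'] conjI Cons.prems(2) d insertI2 u' insertI1)
  next
    case False
    then have "P ?u'" using Cons.prems(4) u' verts by blast
    moreover have "P x \<or> Q x" if "x \<in> path_verts G S ?u' p" for x
      using Cons.prems(4)[of x] that verts by simp
    ultimately have "\<exists>x\<in>path_verts G S ?u' p. \<exists>y\<in>path_verts G S ?u' p. P x \<and> Q y \<and> wdist x y \<le> 1"
      by (rule Cons.IH[OF p _ Cons.prems(3)])
    then show ?thesis unfolding verts by (meson insertI2)
  qed
qed

end

section \<open>From thin triangles to the four-point condition\<close>

locale hyperbolic_group = cayley_group +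
  fixes \<delta> :: real
  assumes \<delta>_nonneg: "0 \<le> \<delta>" and thin: "negatively_curved G S \<delta>"
begin

lemma thin_triangle:
  assumes "geodesic G S x p y" "geodesic G S y q z" "geodesic G S z r x" "v \<in> path_verts G S z r"
  shows "\<exists>u\<in>path_verts G S x p \<union> path_verts G S y q. wdist u v \<le> \<delta>"
proof -
  have "path_verts G S z r \<subseteq> nbhd G S \<delta> (path_verts G S x p \<union> path_verts G S y q)"
    using thin assms unfolding negatively_curved_def by blast
  moreover have "path_verts G S x p \<union> path_verts G S y q \<subseteq> carrier G"
    using geodesic_closed assms(1,2) by blast
  ultimately show ?thesis using assms(4) nbhd_iff by blast
qed

lemma near_geodesic_aux:
  assumes "geodesic G S w p x" "v \<in> path_verts G S w p" "y \<in> carrier G" "wdist v y \<le> r"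
  shows "wdist w y + wdist y x \<le> wdist w x + 2 * r"
proof -
  have c: "w \<in> carrier G" "x \<in> carrier G" "v \<in> carrier G"
    using assms(2) geodesic_closed[OF assms(1)] by blast+
  then show ?thesis
    using geodesic_between[OF assms(1,2)] wdist_triangle[of w v y] wdist_triangle[of y v x]
      wdist_commute[of v y] assms by linarith
qed

text \<open>Each vertex of \<open>p\<close> is \<delta>-close to one of the two sides at
  \<open>w\<close>. Where the side changes, \<open>q\<close> is \<delta>-close to one of them and
  within \<open>\<delta> + 1\<close> of the other; adding the two detour estimates gives the
  constant \<open>2 * \<delta> + 1\<close>.\<close>

lemma geodesic_near_point:
  assumes p: "geodesic G S x p z" and w: "w \<in> carrier G"
  obtains q where "q \<in> path_verts G S x p" "q \<in> carrier G"
    "wdist w q \<le> (wdist w x + wdist w z - wdist x z) / 2 + (2 * \<delta> + 1)"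
proof -
  have xz: "x \<in> carrier G" "z \<in> carrier G" using geodesic_closed[OF p] by blast+
  obtain a b where a: "geodesic G S w a x" and b: "geodesic G S z b w"
    using geodesic_exists[OF w xz(1)] geodesic_exists[OF xz(2) w] by blast
  define P where "P v \<longleftrightarrow> (\<exists>u\<in>path_verts G S w a. wdist u v \<le> \<delta>)" for v
  define Q where "Q v \<longleftrightarrow> (\<exists>u\<in>path_verts G S z b. wdist u v \<le> \<delta>)" for v
  have aw: "cay.awalk w a x" "cay.awalk x p z" "cay.awalk z b w" using a b p by (auto simp: geodesic_iff)
  have "P x" unfolding P_def
    using ends_path_verts(2)[OF aw(1)] wdist_self[OF xz(1)] \<delta>_nonneg by (intro bexI[of _ x]) simp_all
  moreover have "Q z" unfolding Q_def
    using ends_path_verts(1)[OF aw(3)] wdist_self[OF xz(2)] \<delta>_nonneg by (intro bexI[of _ z]) simp_all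
  moreover have "P v \<or> Q v" if "v \<in> path_verts G S x p" for v
    using thin_triangle[OF b a p that] unfolding P_def Q_def by blast
  ultimately obtain q r where qr: "q \<in> path_verts G S x p" "r \<in> path_verts G S x p" "P q" "Q r"
      "wdist q r \<le> 1" using awalk_transition[OF aw(2), of P Q] by blast
  then have c: "q \<in> carrier G" "r \<in> carrier G" using path_verts_closed[OF aw(2)] by auto
  obtain u where "u \<in> path_verts G S w a" "wdist u q \<le> \<delta>" using qr P_def by blast
  then have 1: "wdist w q + wdist q x \<le> wdist w x + 2 * \<delta>"
    using near_geodesic_aux[OF a] c by blast
  obtain v where v: "v \<in> path_verts G S z b" "wdist v r \<le> \<delta>" using qr Q_def by blast
  then have "v \<in> carrier G" using path_verts_closed[OF aw(3)] by auto
  then have "wdist v q \<le> \<delta> + 1"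
    using v qr(5) wdist_triangle[of v r q] c wdist_commute[of q r] by linarith
  then have 2: "wdist z q + wdist q w \<le> wdist z w + 2 * (\<delta> + 1)"
    using near_geodesic_aux[OF b v(1)] c by blast
  have "wdist w q \<le> (wdist w x + wdist w z - wdist x z) / 2 + (2 * \<delta> + 1)"
    using 1 2 geodesic_between[OF p qr(1)] c xz w \<delta>_nonneg
      wdist_commute[of z q] wdist_commute[of z w] wdist_commute[of q w] wdist_commute[of q x]
    by (simp add: field_simps)
  then show thesis using that qr c by blast
qed

text \<open>Two triangle inequalities through \<open>q\<close> add up to this. Together with
  \<open>geodesic_near_point\<close> it shows that a Gromov product is, up to a constant, the
  distance to a geodesic.\<close>

lemma gromov_le_wdist_geodesic:
  assumes "geodesic G S x p y" "q \<in> path_verts G S x p" "w \<in> carrier G"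
  shows "(wdist w x + wdist w y - wdist x y) / 2 \<le> wdist w q"
proof -
  have c: "x \<in> carrier G" "y \<in> carrier G" "q \<in> carrier G"
    using assms(2) geodesic_closed[OF assms(1)] by blast+
  then show ?thesis using geodesic_between[OF assms(1,2)] assms(3)
      wdist_triangle[of w q x] wdist_triangle[of w q y] wdist_commute[of x q]
    by (simp add: field_simps)
qed

text \<open>A vertex \<open>q\<close> of a geodesic from \<open>z\<close> to \<open>x\<close> nearly
  realises their product at \<open>w\<close>. Thinness puts a vertex of another side within \<delta>
  of \<open>q\<close>, and the product belonging to that side is at most the distance from
  \<open>w\<close> to this vertex. The constant is
  \<open>(2 * \<delta> + 1) + \<delta>\<close>.\<close>

sublocale four_point_space "carrier G" wdist "3 * \<delta> + 1"
proof
  fix x y z w assume c: "x \<in> carrier G" "y \<in> carrier G" "z \<in> carrier G" "w \<in> carrier G"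
  obtain p a b where p: "geodesic G S z p x" and a: "geodesic G S x a y" and b: "geodesic G S y b z"
    using geodesic_exists[OF c(3,1)] geodesic_exists[OF c(1,2)] geodesic_exists[OF c(2,3)] by blast
  obtain q where q: "q \<in> path_verts G S z p" "q \<in> carrier G"
    "wdist w q \<le> (wdist w z + wdist w x - wdist z x) / 2 + (2 * \<delta> + 1)"
    using geodesic_near_point[OF p c(4)] by blast
  obtain u where u: "u \<in> path_verts G S x a \<union> path_verts G S y b" "wdist u q \<le> \<delta>"
    using thin_triangle[OF a b p q(1)] by blast
  then have "u \<in> carrier G" using geodesic_closed[OF a] geodesic_closed[OF b] by blast
  then have "wdist w u \<le> wdist w q + \<delta>"
    using wdist_triangle[of w q u] wdist_commute[of u q] q c u by simp
  moreover have "(wdist w x + wdist w y - wdist x y) / 2 \<le> wdist w u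
      \<or> (wdist w y + wdist w z - wdist y z) / 2 \<le> wdist w u"
    using u gromov_le_wdist_geodesic a b c by blast
  moreover have "wdist w u \<le> (wdist w x + wdist w z - wdist x z) / 2 + (3 * \<delta> + 1)"
    if "wdist w u \<le> wdist w q + \<delta>"
    using that q(3) wdist_commute[OF c(1,3)] by (simp add: add.commute)
  ultimately show "min ((wdist w x + wdist w y - wdist x y) / 2) ((wdist w y + wdist w z - wdist y z) / 2)
      \<le> (wdist w x + wdist w z - wdist x z) / 2 + (3 * \<delta> + 1)"
    unfolding min_le_iff_disj using order_trans by blast
qed (use \<delta>_nonneg in \<open>simp_all add: wdist_self wdist_nonneg wdist_triangle wdist_commute\<close>)

end

section \<open>Cancellation between two quasiconvex subgroups\<close>

context hyperbolic_group
begin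

abbreviation "D \<equiv> 3 * \<delta> + 1"

lemma quasiconvex_geodesic_point:
  assumes "quasiconvex_with G S \<mu> H" "subgroup H G" "a \<in> H"
    and "geodesic G S \<one> p a" "x \<in> path_verts G S \<one> p"
  obtains h where "h \<in> H" "wdist h x \<le> \<mu>"
proof -
  have "x \<in> nbhd G S \<mu> H"
    using assms subgroup.one_closed[OF assms(2)] unfolding quasiconvex_with_def by blast
  then show thesis using that nbhd_iff[OF subgroup.subset[OF assms(2)]] by blast
qed

text \<open>A sampling step larger than \<open>2 * \<mu>\<close>, times the number of pigeonholes,
  which are the elements of a ball. The subgroups do not enter.\<close>

definition cancellation_bound :: "real \<Rightarrow> real" where
  "cancellation_bound \<mu> = real ((nat \<lceil>2 * \<mu>\<rceil> + 1)
     * card {g \<in> carrier G. real (word_length G S g) \<le> 2 * \<mu> + 4 * D})"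

text \<open>Along a long common initial segment of the geodesics from \<open>\<one>\<close> to \<open>a\<inverse>\<close> and to \<open>b\<close>, the
  difference between a nearby point of \<open>H\<close> and one of \<open>K\<close> takes some value twice, at distant
  places. This gives an element of \<open>H \<inter> K\<close> by which \<open>a\<close> can be shortened.\<close>

lemma gromov_le_cancellation_bound:
  assumes "finite S"
    and H: "subgroup H G" "quasiconvex_with G S \<mu> H" and K: "subgroup K G" "quasiconvex_with G S \<mu> K"
    and a: "a \<in> H" and b: "b \<in> K"
    and minimal: "\<And>c. c \<in> H \<inter> K \<Longrightarrow> word_length G S a \<le> word_length G S (a \<otimes> c)"
  shows "gromov (inv a) b \<one> \<le> cancellation_bound \<mu>"
proof (rule ccontr)
  assume contr: "\<not> ?thesis"
  have ac: "a \<in> carrier G" and bc: "b \<in> carrier G"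
    using subgroup.mem_carrier[OF H(1) a] subgroup.mem_carrier[OF K(1) b] .
  have ia: "inv a \<in> H" using subgroup.m_inv_closed[OF H(1) a] .
  define B where "B = {g \<in> carrier G. real (word_length G S g) \<le> 2 * \<mu> + 4 * D}"
  define s where "s = nat \<lceil>2 * \<mu>\<rceil> + 1"
  have "finite B" unfolding B_def by (rule finite_word_length_le[OF \<open>finite S\<close>])
  have s: "2 * \<mu> < real s" unfolding s_def by linarith
  \<comment> \<open>The indices from 0 to \<open>card B\<close> are one more than the elements of
    \<open>B\<close>; all sampling distances stay within the common initial segment.\<close>
  have big: "real (s * i) \<le> gromov (inv a) b \<one>" if "i \<le> card B" for i
  proof -
    have "s * i \<le> s * card B" using that by simp
    then have "real (s * i) \<le> real (s * card B)" by (rule of_nat_mono)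
    then show ?thesis using contr unfolding cancellation_bound_def B_def s_def by linarith
  qed
  obtain p q where p: "geodesic G S \<one> p (inv a)" and q: "geodesic G S \<one> q b"
    using geodesic_exists[OF one_closed inv_closed[OF ac]] geodesic_exists[OF one_closed bc] by blast
  have "\<exists>u h v k. u \<in> carrier G \<and> v \<in> carrier G \<and> h \<in> H \<and> k \<in> K
      \<and> wdist h u \<le> \<mu> \<and> wdist k v \<le> \<mu> \<and> wdist u v \<le> 4 * D
      \<and> wdist \<one> u = real (s * i) \<and> wdist \<one> u + wdist u (inv a) = wdist \<one> (inv a)"
    if "i \<le> card B" for i
  proof -
    have t: "real (s * i) \<le> wdist \<one> (inv a)" "real (s * i) \<le> wdist \<one> b"
      using big[OF that] gromov_le_dist[of "inv a" b \<one>] ac bc by auto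
    obtain u where u: "u \<in> path_verts G S \<one> p" "u \<in> carrier G" "wdist \<one> u = real (s * i)"
      "wdist \<one> u + wdist u (inv a) = wdist \<one> (inv a)"
      using geodesic_point[OF p t(1)] by blast
    obtain v where v: "v \<in> path_verts G S \<one> q" "v \<in> carrier G" "wdist \<one> v = real (s * i)"
      "wdist \<one> v + wdist v b = wdist \<one> b"
      using geodesic_point[OF q t(2)] by blast
    obtain h where h: "h \<in> H" "wdist h u \<le> \<mu>"
      using quasiconvex_geodesic_point[OF H(2,1) ia p u(1)] by blast
    obtain k where k: "k \<in> K" "wdist k v \<le> \<mu>"
      using quasiconvex_geodesic_point[OF K(2,1) b q v(1)] by blast
    have "wdist u v \<le> 4 * D"
      by (rule geodesics_fellow_travel[OF one_closed _ bc u(2) v(2) u(3,4) v(3,4) big[OF that]])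
        (simp add: ac)
    then show ?thesis using u v h k by blast
  qed
  then obtain u h v k where uv: "\<And>i. i \<le> card B \<Longrightarrow> u i \<in> carrier G \<and> v i \<in> carrier G
      \<and> h i \<in> H \<and> k i \<in> K \<and> wdist (h i) (u i) \<le> \<mu> \<and> wdist (k i) (v i) \<le> \<mu> \<and> wdist (u i) (v i) \<le> 4 * D
      \<and> wdist \<one> (u i) = real (s * i) \<and> wdist \<one> (u i) + wdist (u i) (inv a) = wdist \<one> (inv a)"
    by metis
  have c: "u i \<in> carrier G" "v i \<in> carrier G" "h i \<in> carrier G" "k i \<in> carrier G" if "i \<le> card B" for i
    using uv[OF that] subgroup.mem_carrier[OF H(1)] subgroup.mem_carrier[OF K(1)] by simp_all
  have "inv (h i) \<otimes> k i \<in> B" if "i \<le> card B" for i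
  proof -
    note ci = c[OF that]
    have "wdist (h i) (k i) \<le> wdist (h i) (u i) + wdist (u i) (v i) + wdist (k i) (v i)"
      using wdist_triangle[OF ci(3,1,4)] wdist_triangle[OF ci(1,2,4)] wdist_commute[OF ci(2,4)]
      by linarith
    then have "wdist (h i) (k i) \<le> 2 * \<mu> + 4 * D" using uv[OF that] by linarith
    then show ?thesis using c[OF that] by (simp add: B_def wdist_def)
  qed
  then have "(\<lambda>i. inv (h i) \<otimes> k i) ` {..card B} \<subseteq> B" by auto
  then have "card ((\<lambda>i. inv (h i) \<otimes> k i) ` {..card B}) \<le> card B"
    using \<open>finite B\<close> card_mono by blast
  then have "\<not> inj_on (\<lambda>i. inv (h i) \<otimes> k i) {..card B}"
    using card_image by fastforce
  then obtain i j where ij: "i < j" "j \<le> card B" "inv (h i) \<otimes> k i = inv (h j) \<otimes> k j"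
    unfolding inj_on_def by (metis atMost_iff linorder_neqE_nat)
  then have i: "i \<le> card B" by simp
  note ci = c[OF i] and cj = c[OF ij(2)] and ui = uv[OF i] and uj = uv[OF ij(2)]
  \<comment> \<open>Equal differences at \<open>i\<close> and \<open>j\<close> mean that
    \<open>z\<close> is also \<open>k j \<otimes> inv (k i)\<close>, so it lies in both
    subgroups.\<close>
  define z where "z = h j \<otimes> inv (h i)"
  have "h j \<otimes> (inv (h i) \<otimes> k i) \<otimes> inv (k i) = h j \<otimes> (inv (h j) \<otimes> k j) \<otimes> inv (k i)"
    using ij(3) by simp
  then have zk: "z = k j \<otimes> inv (k i)"
    using ci cj by (simp add: z_def m_assoc) (simp flip: m_assoc)
  have "z \<in> H" unfolding z_def
    using ui uj subgroup.m_closed[OF H(1)] subgroup.m_inv_closed[OF H(1)] by simp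
  moreover have "z \<in> K" unfolding zk
    using ui uj subgroup.m_closed[OF K(1)] subgroup.m_inv_closed[OF K(1)] by simp
  ultimately have "word_length G S a \<le> word_length G S (a \<otimes> z)" using minimal by blast
  moreover have zc: "z \<in> carrier G" using ci cj by (simp add: z_def)
  \<comment> \<open>The way from \<open>z\<close> to \<open>inv a\<close> through \<open>h j\<close>
    and \<open>u j\<close> replaces an initial part of length \<open>s * j\<close> by one of length
    at most \<open>s * i + 2 * \<mu>\<close>, which is shorter since \<open>s\<close> exceeds
    \<open>2 * \<mu>\<close>.\<close>
  have "real (word_length G S (a \<otimes> z)) = wdist z (inv a)"
    using word_length_inv[of "a \<otimes> z"] ac zc by (simp add: wdist_def inv_mult_group)
  moreover have "wdist z (inv a) \<le> wdist z (h j) + wdist (h j) (u j) + wdist (u j) (inv a)"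
    using wdist_triangle[OF zc cj(3), of "inv a"] wdist_triangle[OF cj(3,1), of "inv a"] ac by simp
  moreover have "wdist z (h j) \<le> wdist \<one> (u i) + \<mu>"
  proof -
    have "wdist z (h j) = wdist (inv (h i)) \<one>"
      using wdist_left_invariant[of "h j" "inv (h i)" \<one>] ci cj by (simp add: z_def)
    also have "\<dots> = wdist \<one> (h i)" using wdist_one[of "h i"] ci by (simp add: wdist_def)
    also have "\<dots> \<le> wdist \<one> (u i) + wdist (h i) (u i)"
      using wdist_triangle[OF one_closed ci(1,3)] wdist_commute[OF ci(1,3)] by simp
    finally show ?thesis using ui by linarith
  qed
  moreover have "real (word_length G S a) = wdist \<one> (inv a)"
    using word_length_inv[OF ac] ac by (simp add: wdist_one)
  moreover have "real (s * j) \<ge> real (s * i) + real s"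
  proof -
    have "s * j \<ge> s * Suc i" using ij(1) by (intro mult_le_mono2) simp
    then have "real (s * j) \<ge> real (s * Suc i)" by (rule of_nat_mono)
    then show ?thesis by simp
  qed
  ultimately show False using ui uj s by linarith
qed

text \<open>After translation by \<open>inv x\<close>, a vertex of a geodesic from \<one> to
  \<open>a\<close> is close to \<open>inv x \<otimes> q\<close>, and quasiconvexity supplies a point
  of \<open>A\<close> within \<mu> of it.\<close>

lemma near_coset:
  assumes A: "subgroup A G" "quasiconvex_with G S \<mu> A" and a: "a \<in> A"
    and c: "x \<in> carrier G" "q \<in> carrier G"
  shows "\<exists>a'\<in>A. wdist (x \<otimes> a') q \<le> gromov x (x \<otimes> a) q + D + \<mu>"
proof -
  have ac: "a \<in> carrier G" using subgroup.mem_carrier[OF A(1) a] .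
  define y where "y = inv x \<otimes> q"
  have y: "y \<in> carrier G" "q = x \<otimes> y" using c by (auto simp: y_def simp flip: m_assoc)
  obtain p where p: "geodesic G S \<one> p a" using geodesic_exists[OF one_closed ac] by blast
  obtain r where r: "r \<in> path_verts G S \<one> p" "r \<in> carrier G"
    "wdist y r \<le> (wdist y \<one> + wdist y a - wdist \<one> a) / 2 + (2 * \<delta> + 1)"
    using geodesic_near_point[OF p y(1)] by blast
  obtain a' where a': "a' \<in> A" "wdist a' r \<le> \<mu>"
    using quasiconvex_geodesic_point[OF A(2,1) a p r(1)] by blast
  then have "a' \<in> carrier G" using subgroup.mem_carrier[OF A(1)] by blast
  then have "wdist (x \<otimes> a') q \<le> wdist y r + \<mu>"
    using wdist_triangle[of a' r y] wdist_commute[of y r] a' y r(2) c(1) wdist_left_invariant by simp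
  moreover have "gromov x (x \<otimes> a) q = (wdist y \<one> + wdist y a - wdist \<one> a) / 2"
    using wdist_left_invariant[OF c(1) y(1) one_closed] wdist_left_invariant[OF c(1) one_closed ac]
      wdist_left_invariant[OF c(1) y(1) ac] c by (simp add: gromov_def y(2))
  ultimately have "wdist (x \<otimes> a') q \<le> gromov x (x \<otimes> a) q + D + \<mu>"
    using r(3) \<delta>_nonneg by linarith
  then show ?thesis using a'(1) by blast
qed

end

section \<open>Reduced words in an amalgamated product\<close>

locale two_subgroups = group G for G (structure) +
  fixes A B :: "'a set"
  assumes A: "subgroup A G" and B: "subgroup B G"
begin

abbreviation "C \<equiv> A \<inter> B"

lemma C: "subgroup C G"
  by (rule subgroups_Inter_pair[OF A B])

sublocale amalg: amalgam_data "G\<lparr>carrier := A\<rparr>" "G\<lparr>carrier := B\<rparr>" "G\<lparr>carrier := C\<rparr>"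
    "\<lambda>x. x" "\<lambda>x. x"
proof -
  note groups = subgroup_imp_group[OF A] subgroup_imp_group[OF B] subgroup_imp_group[OF C]
  show "amalgam_data (G\<lparr>carrier := A\<rparr>) (G\<lparr>carrier := B\<rparr>) (G\<lparr>carrier := C\<rparr>) (\<lambda>x. x) (\<lambda>x. x)"
    by (intro amalgam_data.intro group_hom.intro groups group_hom_axioms.intro) (auto simp: hom_def)
qed

abbreviation "words \<equiv> amalg_words (G\<lparr>carrier := A\<rparr>) (G\<lparr>carrier := B\<rparr>)"
abbreviation "rel \<equiv>
  amalg_rel (G\<lparr>carrier := A\<rparr>) (G\<lparr>carrier := B\<rparr>) (G\<lparr>carrier := C\<rparr>) (\<lambda>x. x) (\<lambda>x. x)"
abbreviation "eval \<equiv> amalg_eval G (\<lambda>x. x) (\<lambda>x. x)"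
abbreviation "lift \<equiv> amalg_lift G (\<lambda>x. x) (\<lambda>x. x)"

text \<open>Booleans index the two factors, so that arguments symmetric in \<open>A\<close> and
  \<open>B\<close> are carried out once.\<close>

definition side :: "bool \<Rightarrow> 'a set" where "side b = (if b then A else B)"
definition mk :: "bool \<Rightarrow> 'a \<Rightarrow> 'a + 'a" where "mk b x = (if b then Inl x else Inr x)"
definition letter :: "'a + 'a \<Rightarrow> 'a" where "letter = case_sum (\<lambda>x. x) (\<lambda>x. x)"

lemma letter_mk [simp]: "letter (mk b x) = x" and isl_mk [simp]: "isl (mk b x) = b"
  by (auto simp: letter_def mk_def)

lemma mk_cases: obtains b x where "s = mk b x"
  by (cases s) (auto simp: mk_def intro: that[of True] that[of False])

lemma words_mk [simp]: "mk b x # w \<in> words \<longleftrightarrow> x \<in> side b \<and> w \<in> words"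
  by (auto simp: mk_def side_def)

lemma side_subgroup: "subgroup (side b) G"
  using A B by (simp add: side_def)

lemma side_simps [simp]:
  "x \<in> side b \<Longrightarrow> x \<in> carrier G"
  "x \<in> side b \<Longrightarrow> y \<in> side b \<Longrightarrow> x \<otimes> y \<in> side b"
  "c \<in> C \<Longrightarrow> c \<in> side b"
  using subgroup.mem_carrier[OF side_subgroup] subgroup.m_closed[OF side_subgroup]
  by (auto simp: side_def)

lemma C_mult_cancel:
  assumes "c \<in> C" "x \<in> carrier G" "x \<otimes> c \<in> C" shows "x \<in> C"
proof -
  have "(x \<otimes> c) \<otimes> inv c \<in> C"
    using assms subgroup.m_closed[OF C] subgroup.m_inv_closed[OF C] by blast
  then show ?thesis using assms subgroup.mem_carrier[OF C] by (simp add: m_assoc)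
qed

lemma eval_Nil [simp]: "eval [] = \<one>"
  and eval_Cons [simp]: "eval (s # w) = letter s \<otimes> eval w"
  by (simp_all add: amalg_eval_def letter_def)

lemma letter_closed: "w \<in> words \<Longrightarrow> s \<in> set w \<Longrightarrow> letter s \<in> side (isl s)"
  by (auto simp: amalg_words_def side_def letter_def)

lemma letter_carrier: "w \<in> words \<Longrightarrow> s \<in> set w \<Longrightarrow> letter s \<in> carrier G"
  using letter_closed side_simps(1) by blast

lemma eval_closed: "w \<in> words \<Longrightarrow> eval w \<in> carrier G"
proof (induction w)
  case (Cons s w)
  then show ?case using letter_carrier[OF Cons.prems, of s] by (auto simp: amalg_words_def)
qed simp

lemma eval_append:
  "v \<in> words \<Longrightarrow> w \<in> words \<Longrightarrow> eval (v @ w) = eval v \<otimes> eval w"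
proof (induction v)
  case (Cons s v)
  then have "v \<in> words" by (auto simp: amalg_words_def)
  then show ?case
    using Cons letter_carrier[OF Cons.prems(1), of s] eval_closed by (simp add: m_assoc)
qed (simp add: eval_closed)

lemma lift_class: "w \<in> words \<Longrightarrow> lift (rel `` {w}) = eval w"
  using subgroup.subset[OF A] subgroup.subset[OF B]
  by (intro amalg.amalg_lift_class is_group) (auto simp: hom_def)

lemma rel_eval: "(v, w) \<in> rel \<Longrightarrow> eval v = eval w"
  using lift_class amalg.rel_words equiv_class_eq[OF amalg.equiv_rel] by metis

section \<open>Rewriting words within their class\<close>

lemma rel_mult:
  "\<lbrakk>u \<in> words; v \<in> words; x \<in> side b; y \<in> side b\<rbrakk>
    \<Longrightarrow> (u @ [mk b x, mk b y] @ v, u @ [mk b (x \<otimes> y)] @ v) \<in> rel"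
  using amalg_rel.mult_left[of u "G\<lparr>carrier := A\<rparr>" "G\<lparr>carrier := B\<rparr>" v x y]
    amalg_rel.mult_right[of u "G\<lparr>carrier := A\<rparr>" "G\<lparr>carrier := B\<rparr>" v x y]
  by (auto simp: mk_def side_def)

text \<open>The sides are arbitrary, possibly equal, so a letter from \<open>C\<close> can later be
  merged with either neighbor without a case distinction.\<close>

lemma rel_switch:
  assumes "u \<in> words" "v \<in> words" "c \<in> C"
  shows "(u @ [mk b c] @ v, u @ [mk b' c] @ v) \<in> rel"
proof -
  have "(u @ [Inl c] @ v, u @ [Inr c] @ v) \<in> rel"
    using assms amalg_rel.glue[of u "G\<lparr>carrier := A\<rparr>" "G\<lparr>carrier := B\<rparr>" v c "G\<lparr>carrier := C\<rparr>"] by simp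
  moreover from this have "(u @ [Inr c] @ v, u @ [Inl c] @ v) \<in> rel" by (rule amalg_rel.sym)
  moreover have "(u @ [mk b c] @ v, u @ [mk b c] @ v) \<in> rel"
    using assms by (intro amalg_rel.refl) simp
  ultimately show ?thesis by (cases b; cases b') (simp_all add: mk_def)
qed

lemma rel_absorb_right:
  assumes "u \<in> words" "v \<in> words" "x \<in> side b" "c \<in> C"
  shows "(u @ [mk b x, mk b' c] @ v, u @ [mk b (x \<otimes> c)] @ v) \<in> rel"
proof (rule amalg_rel.trans)
  show "(u @ [mk b x, mk b' c] @ v, u @ [mk b x, mk b c] @ v) \<in> rel"
    using rel_switch[of "u @ [mk b x]" v c b' b] assms by simp
  show "(u @ [mk b x, mk b c] @ v, u @ [mk b (x \<otimes> c)] @ v) \<in> rel"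
    using rel_mult assms by simp
qed

lemma rel_absorb_left:
  assumes "u \<in> words" "v \<in> words" "x \<in> side b" "c \<in> C"
  shows "(u @ [mk b' c, mk b x] @ v, u @ [mk b (c \<otimes> x)] @ v) \<in> rel"
proof (rule amalg_rel.trans)
  show "(u @ [mk b' c, mk b x] @ v, u @ [mk b c, mk b x] @ v) \<in> rel"
    using rel_switch[of u "mk b x # v" c b' b] assms by simp
  show "(u @ [mk b c, mk b x] @ v, u @ [mk b (c \<otimes> x)] @ v) \<in> rel"
    using rel_mult assms by simp
qed

text \<open>The last letter is not required to be minimal in its coset: when letters are appended on
  the right, the part of it that lies in \<open>C\<close> is passed on to the next letter.\<close>

definition reduced :: "('a \<Rightarrow> nat) \<Rightarrow> ('a + 'a) list \<Rightarrow> bool" where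
  "reduced l w \<longleftrightarrow> w \<in> words \<and> successively (\<lambda>s t. isl s \<noteq> isl t) w \<and> (\<forall>s\<in>set w. letter s \<notin> C) \<and>
     (\<forall>s\<in>set (butlast w). \<forall>c\<in>C. l (letter s) \<le> l (letter s \<otimes> c))"

text \<open>Elements of \<open>C\<close> form a separate case because the letters of a reduced word
  lie outside \<open>C\<close>. They are written on the side \<open>True\<close>, and the letter
  \<one> represents the class of the empty word.\<close>

definition reducible :: "('a \<Rightarrow> nat) \<Rightarrow> ('a + 'a) list \<Rightarrow> bool" where
  "reducible l w \<longleftrightarrow> (\<exists>w'. (w, w') \<in> rel \<and> ((\<exists>c\<in>C. w' = [mk True c]) \<or> w' \<noteq> [] \<and> reduced l w'))"

lemma reducible_rel: "(v, w) \<in> rel \<Longrightarrow> reducible l w \<Longrightarrow> reducible l v"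
  unfolding reducible_def using amalg_rel.trans by blast

lemma reducible_reduced: "w \<noteq> [] \<Longrightarrow> reduced l w \<Longrightarrow> reducible l w"
  unfolding reducible_def using amalg_rel.refl reduced_def by blast

lemma reducible_singleton:
  assumes "x \<in> side b" shows "reducible l [mk b x]"
proof (cases "x \<in> C")
  case True
  then show ?thesis using rel_switch[of "[]" "[]" x b True] unfolding reducible_def by auto
next
  case False
  then show ?thesis using assms by (intro reducible_reduced) (auto simp: reduced_def)
qed

lemma reduced_replace_last:
  assumes "reduced l (v @ [mk b x])" "y \<in> side b" "y \<notin> C"
  shows "reduced l (v @ [mk b y])"
  using assms by (auto simp: reduced_def successively_append_iff)

lemma reduced_snoc:
  assumes "reduced l (v @ [mk b x])" "\<And>c. c \<in> C \<Longrightarrow> l x \<le> l (x \<otimes> c)"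
    and "b' \<noteq> b" "y \<in> side b'" "y \<notin> C"
  shows "reduced l (v @ [mk b x, mk b' y])"
  using assms by (auto simp: reduced_def successively_append_iff butlast_append)

lemma reduced_butlast: "reduced l (v @ [s]) \<Longrightarrow> reduced l v"
  by (auto simp: reduced_def successively_append_iff dest: in_set_butlastD)

text \<open>A letter on the same side, or one in \<open>C\<close>, is merged with the last letter;
  if the result falls into \<open>C\<close>, the letter before takes it up. Otherwise the last
  letter is made shortest in its coset, and the remaining factor from \<open>C\<close> moves to the
  new letter.\<close>

lemma reducible_append:
  assumes red: "reduced l (v @ [mk b t])" and x: "x \<in> side b'"
  shows "reducible l (v @ [mk b t, mk b' x])"
proof -
  have v: "v \<in> words" and t: "t \<in> side b" "t \<notin> C"
    using red by (auto simp: reduced_def)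
  \<comment> \<open>A last letter multiplied by an element of \<open>C\<close> stays outside
    \<open>C\<close>, and no minimality is asked of it.\<close>
  have absorb: "reducible l (u @ [mk e (r \<otimes> c)])"
    if "reduced l (u @ [mk e r])" "c \<in> C" for u e r c
  proof -
    have "r \<in> side e" "r \<notin> C" using that(1) by (auto simp: reduced_def)
    then have "r \<otimes> c \<notin> C" "r \<otimes> c \<in> side e"
      using C_mult_cancel[OF that(2), of r] side_simps(1)[of r e] side_simps(2,3)[of _ e] that(2)
      by blast+
    then show ?thesis using reduced_replace_last[OF that(1)] reducible_reduced by blast
  qed
  consider "b = b'" "t \<otimes> x \<notin> C" | "b = b'" "t \<otimes> x \<in> C" | "b \<noteq> b'" "x \<in> C" | "b \<noteq> b'" "x \<notin> C"
    by blast
  then show ?thesis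
  proof cases
    case 1
    then have "reduced l (v @ [mk b (t \<otimes> x)])"
      using reduced_replace_last[OF red] t x by simp
    moreover have "(v @ [mk b t, mk b' x], v @ [mk b (t \<otimes> x)]) \<in> rel"
      using rel_mult[of v "[]" t b x] v t x 1 by simp
    ultimately show ?thesis using reducible_rel reducible_reduced by blast
  next
    case 2
    then have r: "(v @ [mk b t, mk b' x], v @ [mk b (t \<otimes> x)]) \<in> rel"
      using rel_mult[of v "[]" t b x] v t x by simp
    show ?thesis
    proof (cases v rule: rev_cases)
      case Nil
      then show ?thesis using reducible_rel[OF r] reducible_singleton t x 2 by simp
    next
      case (snoc u s)
      obtain e y where s: "s = mk e y" by (rule mk_cases)
      have ured: "reduced l (u @ [mk e y])" using reduced_butlast[OF red] snoc s by simp
      have "(v @ [mk b (t \<otimes> x)], u @ [mk e (y \<otimes> (t \<otimes> x))]) \<in> rel"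
        using rel_absorb_right[of u "[]" y e "t \<otimes> x" b] v snoc s 2 by simp
      then show ?thesis using reducible_rel[OF r] reducible_rel absorb[OF ured 2(2)] by blast
    qed
  next
    case 3
    have "(v @ [mk b t, mk b' x], v @ [mk b (t \<otimes> x)]) \<in> rel"
      using rel_absorb_right[of v "[]" t b x b'] v t 3 by simp
    then show ?thesis using reducible_rel absorb[OF red 3(2)] by blast
  next
    case 4
    \<comment> \<open>The product \<open>t \<otimes> c\<close> is shortest in the coset of
      \<open>t\<close>, and \<open>inv c\<close> is what is passed on to \<open>x\<close>.\<close>
    obtain c where c: "c \<in> C" "\<And>c'. c' \<in> C \<Longrightarrow> l (t \<otimes> c) \<le> l (t \<otimes> c')"
      using ex_has_least_nat[of "\<lambda>c. c \<in> C" \<one> "\<lambda>c. l (t \<otimes> c)"] subgroup.one_closed[OF C] by blast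
    define m z where "m = t \<otimes> c" and "z = inv c"
    have z: "z \<in> C" "z \<in> carrier G" "c \<in> carrier G" unfolding z_def
      using subgroup.m_inv_closed[OF C c(1)] subgroup.mem_carrier[OF C] c(1) by blast+
    have m: "m \<in> side b" "m \<notin> C" "m \<otimes> z = t"
      unfolding m_def z_def using t(1) z(3) side_simps(3)[OF c(1)] C_mult_cancel[OF c(1) _, of t] t(2)
      by (simp, blast intro: side_simps(1), simp add: m_assoc)
    have zx: "z \<otimes> x \<in> side b'" using x z(1) by simp
    have zxC: "z \<otimes> x \<notin> C"
    proof
      assume "z \<otimes> x \<in> C"
      then have "c \<otimes> (z \<otimes> x) \<in> C" using subgroup.m_closed[OF C c(1)] by blast
      moreover have "c \<otimes> (z \<otimes> x) = x" using z x by (simp add: z_def flip: m_assoc)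
      ultimately show False using 4 by simp
    qed
    have min: "l m \<le> l (m \<otimes> c')" if "c' \<in> C" for c'
      using c(2)[of "c \<otimes> c'"] subgroup.m_closed[OF C c(1) that] t z(3) subgroup.mem_carrier[OF C that]
      by (simp add: m_def m_assoc)
    have "reduced l (v @ [mk b m, mk b' (z \<otimes> x)])"
      using reduced_snoc[OF reduced_replace_last[OF red m(1,2)] min] 4 zx zxC by simp
    moreover have "(v @ [mk b t, mk b' x], v @ [mk b m, mk b z, mk b' x]) \<in> rel"
      using amalg_rel.sym[OF rel_mult[of v "[mk b' x]" m b z]] v m z(1) x by simp
    moreover have "(v @ [mk b m, mk b z, mk b' x], v @ [mk b m, mk b' (z \<otimes> x)]) \<in> rel"
      using rel_absorb_left[of "v @ [mk b m]" "[]" x b' z b] v m z(1) x by simp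
    ultimately show ?thesis using reducible_rel reducible_reduced by blast
  qed
qed

text \<open>Letters are appended one at a time; a prefix that has collapsed to an element of
  \<open>C\<close> is absorbed by the next letter.\<close>

lemma words_reducible: "w \<in> words \<Longrightarrow> reducible l w"
proof (induction w rule: rev_induct)
  case Nil
  have "([], [mk True \<one>]) \<in> rel"
    using amalg_rel.sym[OF amalg_rel.one_left[of "[]" "G\<lparr>carrier := A\<rparr>" "G\<lparr>carrier := B\<rparr>" "[]"]]
    by (simp add: mk_def)
  then show ?case using subgroup.one_closed[OF C] unfolding reducible_def by blast
next
  case (snoc s w)
  obtain b x where s: "s = mk b x" by (rule mk_cases)
  have w: "w \<in> words" "x \<in> side b" using snoc.prems s by auto
  obtain w' where w': "(w, w') \<in> rel" "(\<exists>c\<in>C. w' = [mk True c]) \<or> w' \<noteq> [] \<and> reduced l w'"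
    using snoc.IH[OF w(1)] unfolding reducible_def by blast
  have r: "(w @ [s], w' @ [s]) \<in> rel" using amalg.rel_append1[OF w'(1), of "[s]"] w(2) s by simp
  show ?case
  proof (cases "\<exists>c\<in>C. w' = [mk True c]")
    case True
    then obtain c where c: "c \<in> C" "w' = [mk True c]" by blast
    then have "(w' @ [s], [mk b (c \<otimes> x)]) \<in> rel"
      using rel_absorb_left[of "[]" "[]" x b c True] s w(2) by simp
    moreover have "c \<otimes> x \<in> side b" using c w(2) by simp
    ultimately show ?thesis using reducible_rel[OF r] reducible_rel reducible_singleton by blast
  next
    case False
    then obtain v t where "w' = v @ [t]" "reduced l (v @ [t])" using w'(2) by (metis rev_exhaust)
    moreover obtain e y where "t = mk e y" by (rule mk_cases)
    ultimately show ?thesis using reducible_rel[OF r] reducible_append w(2) s by simp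
  qed
qed

section \<open>From normal forms to the amalgam\<close>

lemma generate_eq_eval: "generate G (A \<union> B) = eval ` words"
proof
  have "letter s \<in> generate G (A \<union> B)" if "w \<in> words" "s \<in> set w" for s w
    using letter_closed[OF that] by (auto simp: side_def intro: generate.incl split: if_splits)
  then show "eval ` words \<subseteq> generate G (A \<union> B)"
  proof safe
    fix w assume *: "\<And>w s. w \<in> words \<Longrightarrow> s \<in> set w \<Longrightarrow> letter s \<in> generate G (A \<union> B)"
    assume "w \<in> words"
    then show "eval w \<in> generate G (A \<union> B)"
    proof (induction w)
      case (Cons s w)
      then have "w \<in> words" by (auto simp: amalg_words_def)
      then show ?case using Cons.IH *[OF Cons.prems, of s] by (auto intro: generate.eng)
    qed (simp add: generate.one)
  qed
next
  have single: "x \<in> eval ` words" if "x \<in> side b" for x b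
    using that by (intro image_eqI[of _ _ "[mk b x]"]) auto
  show "generate G (A \<union> B) \<subseteq> eval ` words"
  proof
    fix g assume "g \<in> generate G (A \<union> B)"
    then show "g \<in> eval ` words"
    proof induction
      case one
      show ?case by (intro image_eqI[of _ _ "[]"]) auto
    next
      case (incl h)
      then show ?case using single[of h True] single[of h False] by (auto simp: side_def)
    next
      case (inv h)
      then show ?case using single[of "inv h" True] single[of "inv h" False]
          subgroup.m_inv_closed[OF A] subgroup.m_inv_closed[OF B] by (auto simp: side_def)
    next
      case (eng g h)
      then obtain v w where "v \<in> words" "g = eval v" "w \<in> words" "h = eval w" by blast
      then show ?case by (intro image_eqI[of _ _ "v @ w"]) (auto simp: eval_append)
    qed
  qed
qed

text \<open>A kernel element is represented by a letter of \<open>C\<close> or by a nonempty reduced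
  word. The assumption excludes the latter, and a letter of \<open>C\<close> with value \<one> is
  \<one> itself. The image is the set of values of words, which is the generated subgroup.\<close>

lemma generate_amalgamI:
  assumes "\<And>w. reduced l w \<Longrightarrow> w \<noteq> [] \<Longrightarrow> eval w \<noteq> \<one>"
  shows "generate_amalgam G A B C"
proof -
  let ?P = "amalgam (G\<lparr>carrier := A\<rparr>) (G\<lparr>carrier := B\<rparr>) (G\<lparr>carrier := C\<rparr>) (\<lambda>x. x) (\<lambda>x. x)"
  have car: "carrier ?P = (\<lambda>w. rel `` {w}) ` words"
    by (auto simp: amalg.carrier_amalgam quotient_def)
  have hom: "lift \<in> hom ?P G"
    by (rule homI) (auto simp: car amalg.mult_class lift_class eval_append eval_closed)
  interpret P: group ?P by (rule amalg.group_amalgam)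
  interpret lift: group_hom ?P G lift by unfold_locales (rule hom)
  have "U = \<one>\<^bsub>?P\<^esub>" if U: "U \<in> carrier ?P" "lift U = \<one>" for U
  proof -
    obtain w where w: "w \<in> words" "U = rel `` {w}" using U car by auto
    then have w1: "eval w = \<one>" using U lift_class by simp
    obtain w' where w': "(w, w') \<in> rel" "(\<exists>c\<in>C. w' = [mk True c]) \<or> w' \<noteq> [] \<and> reduced l w'"
      using words_reducible[OF w(1), of l] unfolding reducible_def by blast
    then obtain c where c: "c \<in> C" "w' = [mk True c]"
      using assms[of w'] rel_eval[OF w'(1)] w1 by auto
    then have "c = \<one>" using rel_eval[OF w'(1)] w1 subgroup.mem_carrier[OF C c(1)] by simp
    then have "(w', []) \<in> rel"
      using amalg_rel.one_left[of "[]" "G\<lparr>carrier := A\<rparr>" "G\<lparr>carrier := B\<rparr>" "[]"] c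
      by (simp add: mk_def)
    then have "(w, []) \<in> rel" using w'(1) amalg_rel.trans by blast
    then show ?thesis unfolding w(2) amalg.one_amalgam by (rule equiv_class_eq[OF amalg.equiv_rel])
  qed
  then have inj: "inj_on lift (carrier ?P)" by (simp add: lift.inj_on_one_iff)
  have im: "lift ` carrier ?P = generate G (A \<union> B)"
    unfolding car generate_eq_eval image_image using lift_class by (intro image_cong) auto
  have "lift \<in> hom ?P (G\<lparr>carrier := generate G (A \<union> B)\<rparr>)"
    using hom im by (auto simp: hom_def)
  then show ?thesis using inj im unfolding generate_amalgam_def iso_def bij_betw_def by simp
qed

end

section \<open>Combination of quasiconvex subgroups\<close>

lemma quasiconvex_with_mono:
  assumes "quasiconvex_with G S r T" "r \<le> r'"
  shows "quasiconvex_with G S r' T"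
proof -
  have "ereal r \<le> ereal r'" using assms(2) by simp
  then have "nbhd G S r T \<subseteq> nbhd G S r' T"
    unfolding nbhd_def using order_trans by blast
  then show ?thesis using assms(1) unfolding quasiconvex_with_def by blast
qed

text \<open>\<open>A\<close> and \<open>B\<close> stand for \<open>H\<^sub>1\<close> and
  \<open>K\<^sub>1\<close>. The bound in \<open>long\<close> is the length required of the pieces of
  a broken geodesic with \<open>M\<close> equal to \<open>cancellation_bound \<mu>\<close>.\<close>

locale ping_pong = hyperbolic_group G S \<delta> + two_subgroups G A B
  for G (structure) and S and \<delta> and A and B +
  fixes H K :: "'a set" and \<mu> :: real
  assumes finite: "finite S"
    and H: "subgroup H G" "quasiconvex_with G S \<mu> H"
    and K: "subgroup K G" "quasiconvex_with G S \<mu> K"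
    and AH: "A \<subseteq> H" and BK: "B \<subseteq> K" and AB: "A \<inter> B = H \<inter> K"
    and long: "x \<in> A \<union> B \<Longrightarrow> x \<notin> C \<Longrightarrow>
      real (word_length G S x) \<ge> 2 * cancellation_bound \<mu> + 3 * D + 1"
begin

lemma cancellation_bound_nonneg: "cancellation_bound \<mu> \<ge> 0"
  by (simp add: cancellation_bound_def)

lemma letters_gromov:
  assumes "a \<in> side b" "a' \<in> side (\<not> b)"
    and "\<And>c. c \<in> C \<Longrightarrow> word_length G S a \<le> word_length G S (a \<otimes> c)"
  shows "gromov (inv a) a' \<one> \<le> cancellation_bound \<mu>"
proof (cases b)
  case True
  then have "a \<in> H" "a' \<in> K" using assms(1,2) AH BK by (auto simp: side_def)
  then show ?thesis
    by (rule gromov_le_cancellation_bound[OF finite H K]) (use assms(3) AB in blast)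
next
  case False
  then have "a \<in> K" "a' \<in> H" using assms(1,2) AH BK by (auto simp: side_def)
  then show ?thesis
    by (rule gromov_le_cancellation_bound[OF finite K H]) (use assms(3) AB in blast)
qed

text \<open>The breaks of the path that \<open>w\<close> describes from \<open>u\<close>. The free
  starting point serves for geodesics between arbitrary elements of the generated subgroup.\<close>

definition vertex :: "'a \<Rightarrow> ('a + 'a) list \<Rightarrow> nat \<Rightarrow> 'a" where
  "vertex u w i = u \<otimes> eval (take i w)"

lemma vertex_closed:
  assumes "w \<in> words" "u \<in> carrier G" shows "vertex u w i \<in> carrier G"
proof -
  have "take i w \<in> words" using assms(1) by (auto simp: amalg_words_def dest: in_set_takeD)
  then show ?thesis using assms(2) eval_closed by (simp add: vertex_def)
qed

lemma vertex_Suc: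
  assumes "w \<in> words" "u \<in> carrier G" "i < length w"
  shows "vertex u w (Suc i) = vertex u w i \<otimes> letter (w ! i)"
proof -
  have "take i w \<in> words" "[w ! i] \<in> words"
    using assms(1,3) by (auto simp: amalg_words_def dest: in_set_takeD)
  moreover have "letter (w ! i) \<in> carrier G" using letter_carrier assms by simp
  ultimately show ?thesis using assms
    by (simp add: vertex_def take_Suc_conv_app_nth eval_append eval_closed m_assoc)
qed

text \<open>Pieces are long because letters avoid \<open>C\<close>. Translating a break to \<one>
  turns its Gromov product into that of the inverse of a letter and the next letter, to which the
  cancellation bound applies.\<close>

lemma reduced_broken_geodesic:
  assumes red: "reduced (word_length G S) w" and u: "u \<in> carrier G"
  shows "broken_geodesic (cancellation_bound \<mu>) (vertex u w) (length w)"
proof -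
  have w: "w \<in> words" using red by (simp add: reduced_def)
  note closed = vertex_closed[OF w u] and Suc = vertex_Suc[OF w u]
  have "2 * cancellation_bound \<mu> + 3 * D + 1 \<le> wdist (vertex u w i) (vertex u w (Suc i))"
    if "i < length w" for i
  proof -
    have a: "letter (w ! i) \<in> side (isl (w ! i))" "letter (w ! i) \<notin> C"
      using letter_closed[OF w] red that by (simp_all add: reduced_def)
    then have "letter (w ! i) \<in> A \<union> B" by (auto simp: side_def split: if_splits)
    moreover have "wdist (vertex u w i) (vertex u w (Suc i)) = real (word_length G S (letter (w ! i)))"
      using Suc[OF that] closed side_simps(1)[OF a(1)] by (simp add: wdist_def flip: m_assoc)
    ultimately show ?thesis using long a(2) by simp
  qed
  moreover have "gromov (vertex u w i) (vertex u w (Suc (Suc i))) (vertex u w (Suc i))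
      \<le> cancellation_bound \<mu>" if i: "Suc (Suc i) \<le> length w" for i
  proof -
    define y a b where "y = vertex u w (Suc i)" and "a = letter (w ! i)" and "b = letter (w ! Suc i)"
    have "w = take i w @ w ! i # w ! Suc i # drop (Suc (Suc i)) w"
      using i by (metis Cons_nth_drop_Suc Suc_le_lessD append_take_drop_id Suc_lessD)
    then have "successively (\<lambda>s t. isl s \<noteq> isl t) (take i w @ w ! i # w ! Suc i # drop (Suc (Suc i)) w)"
      using red by (simp add: reduced_def)
    then have alternate: "isl (w ! Suc i) \<longleftrightarrow> \<not> isl (w ! i)"
      by (auto simp: successively_append_iff)
    have a: "a \<in> side (isl (w ! i))" and b: "b \<in> side (\<not> isl (w ! i))"
      using letter_closed[OF w, of "w ! i"] letter_closed[OF w, of "w ! Suc i"] i alternate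
      by (simp_all add: a_def b_def)
    \<comment> \<open>Another letter follows \<open>w ! i\<close>, so it is among those known to be
      shortest in their cosets.\<close>
    have "butlast w ! i = w ! i" "i < length (butlast w)" using i by (simp_all add: nth_butlast)
    then have "w ! i \<in> set (butlast w)" by (metis nth_mem)
    then have "gromov (inv a) b \<one> \<le> cancellation_bound \<mu>"
      using letters_gromov[OF a b] red by (simp add: reduced_def a_def)
    moreover have ac: "a \<in> carrier G" and bc: "b \<in> carrier G" and yc: "y \<in> carrier G"
      using side_simps(1) a b closed y_def by blast+
    have "vertex u w i = y \<otimes> inv a" "vertex u w (Suc (Suc i)) = y \<otimes> b"
      using Suc[of i] Suc[of "Suc i"] i closed[of i] ac by (simp_all add: y_def a_def b_def m_assoc)
    then have "gromov (vertex u w i) (vertex u w (Suc (Suc i))) y = gromov (inv a) b \<one>"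
      using wdist_left_invariant[OF yc one_closed, of "inv a"] wdist_left_invariant[OF yc one_closed bc]
        wdist_left_invariant[OF yc _ bc, of "inv a"] ac yc by (simp add: gromov_def)
    ultimately show ?thesis by (simp add: y_def)
  qed
  ultimately show ?thesis using closed by (simp add: broken_geodesic_def)
qed

lemma reduced_eval_neq_one:
  assumes "reduced (word_length G S) w" "w \<noteq> []" shows "eval w \<noteq> \<one>"
proof
  assume "eval w = \<one>"
  then have "vertex \<one> w (length w) = vertex \<one> w 0" by (simp add: vertex_def)
  moreover have "wdist (vertex \<one> w 0) (vertex \<one> w (length w)) > 0"
    using broken_geodesic_dist_pos[OF reduced_broken_geodesic[OF assms(1) one_closed]]
      cancellation_bound_nonneg assms(2) by simp
  ultimately show False using wdist_self[OF one_closed] by (simp add: vertex_def)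
qed

lemma generate_amalgam: "generate_amalgam G A B (H \<inter> K)"
  using generate_amalgamI[OF reduced_eval_neq_one] AB by simp

text \<open>The breaks of the path spelled by a reduced word lie in the generated subgroup. A point
  of the geodesic is near a break, or its product with respect to a piece is at most
  \<open>2 * D\<close>; then \<open>near_coset\<close> gives a point of the coset containing that
  piece's ends within \<open>3 * D + \<nu>\<close>.\<close>

lemma quasiconvex_generate:
  assumes "quasiconvex_with G S \<nu> A" "quasiconvex_with G S \<nu> B" and "\<nu> \<ge> 0"
  shows "quasiconvex_with G S (cancellation_bound \<mu> + 5 * D + \<nu>) (generate G (A \<union> B))"
  unfolding quasiconvex_with_def
proof (intro ballI allI impI subsetI)
  let ?P = "generate G (A \<union> B)"
  have P: "subgroup ?P G"
    using generate_is_subgroup subgroup.subset[OF A] subgroup.subset[OF B] by simp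
  have evalP: "eval w \<in> ?P" if "w \<in> words" for w
    using generate_eq_eval that by blast
  have sideP: "side b \<subseteq> ?P" for b
    by (auto simp: side_def intro: generate.incl)
  have D: "D \<ge> 0" using \<delta>_nonneg by simp
  fix u v p q assume uv: "u \<in> ?P" "v \<in> ?P" and p: "geodesic G S u p v" and q: "q \<in> path_verts G S u p"
  note c = geodesic_closed(1,2)[OF p]
  have qc: "q \<in> carrier G" using geodesic_closed(3)[OF p] q by blast
  have between: "wdist u q + wdist q v = wdist u v" by (rule geodesic_between[OF p q])
  have near: "\<exists>t\<in>?P. wdist t q \<le> gromov x (x \<otimes> a) q + D + \<nu>"
    if x: "x \<in> ?P" and a: "a \<in> side b" for x a b
  proof -
    have "quasiconvex_with G S \<nu> (side b)" using assms by (simp add: side_def)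
    then obtain a' where "a' \<in> side b" "wdist (x \<otimes> a') q \<le> gromov x (x \<otimes> a) q + D + \<nu>"
      using near_coset[OF side_subgroup _ a subgroup.mem_carrier[OF P x] qc] by blast
    moreover from this have "x \<otimes> a' \<in> ?P" using subgroup.m_closed[OF P x] sideP by blast
    ultimately show ?thesis by blast
  qed
  have "inv u \<otimes> v \<in> ?P"
    using uv subgroup.m_closed[OF P] subgroup.m_inv_closed[OF P] by simp
  then have "inv u \<otimes> v \<in> eval ` words" by (simp only: generate_eq_eval)
  then obtain w where w: "w \<in> words" "eval w = inv u \<otimes> v" by force
  obtain w' where "(w, w') \<in> rel"
      and w'_cases: "(\<exists>c\<in>C. w' = [mk True c]) \<or> w' \<noteq> [] \<and> reduced (word_length G S) w'"
    using words_reducible[OF w(1), of "word_length G S"] unfolding reducible_def by blast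
  then have v: "v = u \<otimes> eval w'" using rel_eval w c by (simp flip: m_assoc)
  have "\<exists>t\<in>?P. wdist t q \<le> cancellation_bound \<mu> + 5 * D + \<nu>"
    using w'_cases
  proof (elim disjE)
    assume "\<exists>c\<in>C. w' = [mk True c]"
    then obtain c where "c \<in> side True" "w' = [mk True c]" using side_simps(3) by blast
    then have "v = u \<otimes> c" "c \<in> side True" using v by auto
    \<comment> \<open>A single letter joins \<open>u\<close> to \<open>v\<close>, so the whole
      geodesic plays the part of a piece.\<close>
    moreover have "gromov u v q = 0"
      using between wdist_commute c qc by (simp add: gromov_def)
    ultimately obtain t where "t \<in> ?P" "wdist t q \<le> D + \<nu>"
      using near[OF uv(1), of c True] by auto
    moreover have "D + \<nu> \<le> cancellation_bound \<mu> + 5 * D + \<nu>"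
      using cancellation_bound_nonneg \<delta>_nonneg by simp
    ultimately show ?thesis using order_trans by blast
  next
    assume "w' \<noteq> [] \<and> reduced (word_length G S) w'"
    then have red: "reduced (word_length G S) w'" and w': "w' \<in> words" by (auto simp: reduced_def)
    have ends: "vertex u w' 0 = u" "vertex u w' (length w') = v"
      using c v by (simp_all add: vertex_def)
    have xP: "vertex u w' i \<in> ?P" for i
    proof -
      have "take i w' \<in> words" using w' by (auto simp: amalg_words_def dest: in_set_takeD)
      then show ?thesis using subgroup.m_closed[OF P uv(1) evalP] by (simp add: vertex_def)
    qed
    obtain i where "wdist (vertex u w' i) q \<le> cancellation_bound \<mu> + 5 * D
        \<or> i < length w' \<and> gromov (vertex u w' i) (vertex u w' (Suc i)) q \<le> 2 * D"
      using broken_geodesic_shadow[OF reduced_broken_geodesic[OF red c(1)]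
          cancellation_bound_nonneg qc] between unfolding ends by blast
    then show ?thesis
    proof (elim disjE conjE)
      assume "wdist (vertex u w' i) q \<le> cancellation_bound \<mu> + 5 * D"
      then have "wdist (vertex u w' i) q \<le> cancellation_bound \<mu> + 5 * D + \<nu>"
        using \<open>\<nu> \<ge> 0\<close> by linarith
      then show ?thesis using xP by blast
    next
      assume i: "i < length w'" and g: "gromov (vertex u w' i) (vertex u w' (Suc i)) q \<le> 2 * D"
      obtain t where "t \<in> ?P"
          "wdist t q \<le> gromov (vertex u w' i) (vertex u w' i \<otimes> letter (w' ! i)) q + D + \<nu>"
        using near[OF xP letter_closed[OF w' nth_mem[OF i]]] by blast
      moreover from this have "wdist t q \<le> cancellation_bound \<mu> + 5 * D + \<nu>"
        using g vertex_Suc[OF w' c(1) i] cancellation_bound_nonneg D by simp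
      ultimately show ?thesis by blast
    qed
  qed
  then show "q \<in> nbhd G S (cancellation_bound \<mu> + 5 * D + \<nu>) ?P"
    using nbhd_iff[OF subgroup.subset[OF P]] qc by blast
qed

end

theorem theorem1:
  fixes G :: "('a, 'm) monoid_scheme" and S :: "'a set" and \<delta> \<mu> :: real
  assumes "group G"
    and "finite S" and "S \<subseteq> carrier G" and "generate G S = carrier G"
    and "\<delta> \<ge> 0" and "negatively_curved G S \<delta>"
    and "\<mu> \<ge> 0"
  shows "\<exists>C\<^sub>0 :: real. \<forall>H K H\<^sub>1 K\<^sub>1.
    subgroup H G \<and> quasiconvex_with G S \<mu> H \<and>
    subgroup K G \<and> quasiconvex_with G S \<mu> K \<and>
    subgroup H\<^sub>1 G \<and> H\<^sub>1 \<subseteq> H \<and> subgroup K\<^sub>1 G \<and> K\<^sub>1 \<subseteq> K \<and> H\<^sub>1 \<inter> K\<^sub>1 = H \<inter> K \<and>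
    (\<forall>h\<in>H\<^sub>1. real (word_length G S h) < C\<^sub>0 \<longrightarrow> h \<in> H \<inter> K) \<and>
    (\<forall>k\<in>K\<^sub>1. real (word_length G S k) < C\<^sub>0 \<longrightarrow> k \<in> H \<inter> K)
    \<longrightarrow> generate_amalgam G H\<^sub>1 K\<^sub>1 (H \<inter> K) \<and>
        (quasiconvex G S H\<^sub>1 \<and> quasiconvex G S K\<^sub>1 \<longrightarrow>
           quasiconvex G S (generate G (H\<^sub>1 \<union> K\<^sub>1)))"
proof -
  have "cayley_group G S"
    by (rule cayley_group.intro[OF assms(1) cayley_group_axioms.intro[OF assms(3,4)]])
  then interpret hyperbolic_group G S \<delta>
    by (rule hyperbolic_group.intro[OF _ hyperbolic_group_axioms.intro[OF assms(5,6)]])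
  show ?thesis
  \<comment> \<open>The length that pieces need when products at the breaks are at most
    \<open>cancellation_bound \<mu>\<close>; it is fixed before the subgroups are.\<close>
  proof (intro exI[of _ "2 * cancellation_bound \<mu> + 3 * D + 1"] allI impI)
    fix H K H\<^sub>1 K\<^sub>1
    assume *: "subgroup H G \<and> quasiconvex_with G S \<mu> H \<and>
      subgroup K G \<and> quasiconvex_with G S \<mu> K \<and>
      subgroup H\<^sub>1 G \<and> H\<^sub>1 \<subseteq> H \<and> subgroup K\<^sub>1 G \<and> K\<^sub>1 \<subseteq> K \<and> H\<^sub>1 \<inter> K\<^sub>1 = H \<inter> K \<and>
      (\<forall>h\<in>H\<^sub>1. real (word_length G S h) < 2 * cancellation_bound \<mu> + 3 * D + 1 \<longrightarrow> h \<in> H \<inter> K) \<and>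
      (\<forall>k\<in>K\<^sub>1. real (word_length G S k) < 2 * cancellation_bound \<mu> + 3 * D + 1 \<longrightarrow> k \<in> H \<inter> K)"
    then have long: "2 * cancellation_bound \<mu> + 3 * D + 1 \<le> real (word_length G S x)"
      if "x \<in> H\<^sub>1 \<union> K\<^sub>1" "x \<notin> H \<inter> K" for x
      using that by (metis UnE linorder_not_le)
    interpret two_subgroups G H\<^sub>1 K\<^sub>1
      using * by (intro two_subgroups.intro two_subgroups_axioms.intro is_group) blast+
    have "ping_pong_axioms G S \<delta> H\<^sub>1 K\<^sub>1 H K \<mu>"
      by (rule ping_pong_axioms.intro) (use * long \<open>finite S\<close> in \<open>simp_all only: simp_thms\<close>)
    then interpret ping_pong G S \<delta> H\<^sub>1 K\<^sub>1 H K \<mu>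
      by (intro ping_pong.intro hyperbolic_group_axioms two_subgroups_axioms)
    have "quasiconvex G S (generate G (H\<^sub>1 \<union> K\<^sub>1))"
      if qc: "quasiconvex G S H\<^sub>1" "quasiconvex G S K\<^sub>1"
    proof -
      obtain r s where rs: "r \<ge> 0" "quasiconvex_with G S r H\<^sub>1" "quasiconvex_with G S s K\<^sub>1"
        using qc by (auto simp: quasiconvex_def)
      \<comment> \<open>The maximum of \<open>r\<close> and \<open>s\<close> is a quasiconvexity
        constant for both factors.\<close>
      have "quasiconvex_with G S (cancellation_bound \<mu> + 5 * D + max r s) (generate G (H\<^sub>1 \<union> K\<^sub>1))"
        using rs(1) by (intro quasiconvex_generate quasiconvex_with_mono[OF rs(2)]
            quasiconvex_with_mono[OF rs(3)]) auto
      moreover have "cancellation_bound \<mu> + 5 * D + max r s \<ge> 0"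
        using cancellation_bound_nonneg D_nonneg rs(1) by simp
      ultimately show ?thesis unfolding quasiconvex_def by blast
    qed
    then show "generate_amalgam G H\<^sub>1 K\<^sub>1 (H \<inter> K) \<and>
        (quasiconvex G S H\<^sub>1 \<and> quasiconvex G S K\<^sub>1 \<longrightarrow> quasiconvex G S (generate G (H\<^sub>1 \<union> K\<^sub>1)))"
      using generate_amalgam by blast
  qed
qed

end
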